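(* Let $\phi:M\to M'$ be a semigroup homomorphism between monoids, let $\tau,\tau'$ be topologies on $M,M'$ respectively, and let $f:\mathrm{PSh}(M)\to\mathrm{PSh}(M')$ be the essential geometric morphism induced by $\phi$. Then the following are equivalent: 1. $f^*:\mathrm{PSh}(M')\to\mathrm{PSh}(M)$ maps every $(M',\tau')$-set to an $(M,\tau)$-set. 2. $\phi$ is continuous with respect to $\tau$ and $\tilde\tau'$. 3. The composite functor $Rf^*V':\mathrm{Cont}(M',\tau')\to\mathrm{Cont}(M,\tau)$ (is left exact and) has a right adjoint $G$ satisfying $GR\cong R'f_*$; that is, $f$ restricts along the functors $V,V'$ to a geometric morphism $(G\dashv Rf^*V'):\mathrm{Cont}(M,\tau)\to\mathrm{Cont}(M',\tau')$ making the square of geometric morphisms formed with $(V\dashv R)$, $(V'\dashv R')$ and $f$ commute.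
   Context: $\mathrm{PSh}(M)$ is the topos of right $M$-sets. A semigroup homomorphism need not preserve the identity. The essential geometric morphism $f$ induced by $\phi$ has inverse image $f^*(X)=X\otimes_{M'}M'\phi(1)\cong\{x\in X\mid x\phi(1)=x\}$ with $M$ acting by $x\cdot m=x\phi(m)$; it has a left adjoint $f_!$ and a right adjoint $f_*$. An $(M,\tau)$-set is a right $M$-set $X$ whose action $X\times M\to X$ is continuous when $X$ is given the discrete topology; $\mathrm{Cont}(M,\tau)\subseteq\mathrm{PSh}(M)$ is the full subcategory on these. $V:\mathrm{Cont}(M,\tau)\to\mathrm{PSh}(M)$ and $V':\mathrm{Cont}(M',\tau')\to\mathrm{PSh}(M')$ are the inclusions, and $R,R'$ their right adjoints; $(V\dashv R)$ and $(V'\dashv R')$ are geometric morphisms. For $A\subseteq M'$, $p\in M'$: $p^*(A)=\{m\mid pm\in A\}$, $\mathcal{I}_A^p=\{m\mid m^*(A)=p^*(A)\}$. The action topology $\tilde\tau'$ induced by $\tau'$ has base $\{A\subseteq M'\mid\forall p,q\in M',\ \mathcal{I}^p_{q^*(A)}\in\tau'\}$. Topologies are arbitrary (multiplication need not be continuous). *)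

theory Defs
  imports "HOL-Analysis.Product_Topology" "HOL-Library.Equipollence" "HOL-Library.FuncSet"
begin

section \<open>Categories, functors, adjunctions\<close>

text \<open>Arrows do not carry their domain and codomain, hom-sets may overlap, and all operations
  take the objects involved as arguments; \<open>Comp C X Y Z g h\<close> is \<open>g\<close> after \<open>h\<close> for
  \<open>h : X \<rightarrow> Y\<close>, \<open>g : Y \<rightarrow> Z\<close>.\<close>

record ('o, 'a) category =
  Obj :: "'o set"
  Hom :: "'o \<Rightarrow> 'o \<Rightarrow> 'a set"
  Idn :: "'o \<Rightarrow> 'a"
  Comp :: "'o \<Rightarrow> 'o \<Rightarrow> 'o \<Rightarrow> 'a \<Rightarrow> 'a \<Rightarrow> 'a"

definition is_category :: "('o, 'a) category \<Rightarrow> bool" where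
  "is_category C \<longleftrightarrow>
    (\<forall>X\<in>Obj C. Idn C X \<in> Hom C X X) \<and>
    (\<forall>X\<in>Obj C. \<forall>Y\<in>Obj C. \<forall>Z\<in>Obj C. \<forall>h\<in>Hom C X Y. \<forall>g\<in>Hom C Y Z. Comp C X Y Z g h \<in> Hom C X Z) \<and>
    (\<forall>X\<in>Obj C. \<forall>Y\<in>Obj C. \<forall>h\<in>Hom C X Y.
       Comp C X X Y h (Idn C X) = h \<and> Comp C X Y Y (Idn C Y) h = h) \<and>
    (\<forall>W\<in>Obj C. \<forall>X\<in>Obj C. \<forall>Y\<in>Obj C. \<forall>Z\<in>Obj C. \<forall>h\<in>Hom C W X. \<forall>g\<in>Hom C X Y. \<forall>k\<in>Hom C Y Z.
       Comp C W Y Z k (Comp C W X Y g h) = Comp C W X Z (Comp C X Y Z k g) h)"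

definition full_subcategory :: "('o, 'a) category \<Rightarrow> ('o \<Rightarrow> bool) \<Rightarrow> ('o, 'a) category" where
  "full_subcategory C P = C\<lparr>Obj := {X \<in> Obj C. P X}\<rparr>"

definition is_iso :: "('o, 'a) category \<Rightarrow> 'o \<Rightarrow> 'o \<Rightarrow> 'a \<Rightarrow> bool" where
  "is_iso C X Y h \<longleftrightarrow>
    h \<in> Hom C X Y \<and> (\<exists>g\<in>Hom C Y X. Comp C X Y X g h = Idn C X \<and> Comp C Y X Y h g = Idn C Y)"

record ('o, 'a, 'p, 'b) ftor =
  Fobj :: "'o \<Rightarrow> 'p"
  Farr :: "'o \<Rightarrow> 'o \<Rightarrow> 'a \<Rightarrow> 'b"

definition is_functor :: "('o, 'a) category \<Rightarrow> ('p, 'b) category \<Rightarrow> ('o, 'a, 'p, 'b) ftor \<Rightarrow> bool" where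
  "is_functor C D F \<longleftrightarrow>
    (\<forall>X\<in>Obj C. Fobj F X \<in> Obj D) \<and>
    (\<forall>X\<in>Obj C. \<forall>Y\<in>Obj C. \<forall>h\<in>Hom C X Y. Farr F X Y h \<in> Hom D (Fobj F X) (Fobj F Y)) \<and>
    (\<forall>X\<in>Obj C. Farr F X X (Idn C X) = Idn D (Fobj F X)) \<and>
    (\<forall>X\<in>Obj C. \<forall>Y\<in>Obj C. \<forall>Z\<in>Obj C. \<forall>h\<in>Hom C X Y. \<forall>g\<in>Hom C Y Z.
       Farr F X Z (Comp C X Y Z g h)
         = Comp D (Fobj F X) (Fobj F Y) (Fobj F Z) (Farr F Y Z g) (Farr F X Y h))"

definition comp_functor ::
  "('p, 'b, 'q, 'c) ftor \<Rightarrow> ('o, 'a, 'p, 'b) ftor \<Rightarrow> ('o, 'a, 'q, 'c) ftor"  (infixl "\<circ>\<^sub>F" 55)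
  where
  "G \<circ>\<^sub>F F = \<lparr>Fobj = (\<lambda>X. Fobj G (Fobj F X)),
             Farr = (\<lambda>X Y h. Farr G (Fobj F X) (Fobj F Y) (Farr F X Y h))\<rparr>"

definition inclusion_functor :: "('o, 'a, 'o, 'a) ftor" where
  "inclusion_functor = \<lparr>Fobj = (\<lambda>X. X), Farr = (\<lambda>X Y h. h)\<rparr>"

definition nat_iso ::
  "('o, 'a) category \<Rightarrow> ('p, 'b) category \<Rightarrow>
   ('o, 'a, 'p, 'b) ftor \<Rightarrow> ('o, 'a, 'p, 'b) ftor \<Rightarrow> bool" where
  "nat_iso C D F G \<longleftrightarrow>
    (\<exists>\<alpha>. (\<forall>X\<in>Obj C. is_iso D (Fobj F X) (Fobj G X) (\<alpha> X)) \<and>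
         (\<forall>X\<in>Obj C. \<forall>Y\<in>Obj C. \<forall>h\<in>Hom C X Y.
            Comp D (Fobj F X) (Fobj F Y) (Fobj G Y) (\<alpha> Y) (Farr F X Y h)
              = Comp D (Fobj F X) (Fobj G X) (Fobj G Y) (Farr G X Y h) (\<alpha> X)))"

text \<open>\<open>L : C \<rightarrow> D\<close> is left adjoint to \<open>R : D \<rightarrow> C\<close>.\<close>

definition adjunction ::
  "('o, 'a) category \<Rightarrow> ('p, 'b) category \<Rightarrow>
   ('o, 'a, 'p, 'b) ftor \<Rightarrow> ('p, 'b, 'o, 'a) ftor \<Rightarrow> bool" where
  "adjunction C D L R \<longleftrightarrow>
    is_functor C D L \<and> is_functor D C R \<and>
    (\<exists>\<Phi>. (\<forall>X\<in>Obj C. \<forall>Y\<in>Obj D.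
            bij_betw (\<Phi> X Y) (Hom D (Fobj L X) Y) (Hom C X (Fobj R Y))) \<and>
         (\<forall>X\<in>Obj C. \<forall>X'\<in>Obj C. \<forall>Y\<in>Obj D. \<forall>Y'\<in>Obj D.
            \<forall>u\<in>Hom C X' X. \<forall>h\<in>Hom D (Fobj L X) Y. \<forall>v\<in>Hom D Y Y'.
              \<Phi> X' Y' (Comp D (Fobj L X') Y Y' v
                        (Comp D (Fobj L X') (Fobj L X) Y h (Farr L X' X u)))
              = Comp C X' (Fobj R Y) (Fobj R Y') (Farr R Y Y' v)
                  (Comp C X' X (Fobj R Y) (\<Phi> X Y h) u)))"

section \<open>Finite limits and geometric morphisms\<close>

definition is_cone ::
  "('o, 'a) category \<Rightarrow> ('j, 'k) category \<Rightarrow> ('j, 'k, 'o, 'a) ftor \<Rightarrow> 'o \<Rightarrow> ('j \<Rightarrow> 'a) \<Rightarrow> bool" where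
  "is_cone C J D X \<mu> \<longleftrightarrow>
    X \<in> Obj C \<and> (\<forall>i\<in>Obj J. \<mu> i \<in> Hom C X (Fobj D i)) \<and>
    (\<forall>i\<in>Obj J. \<forall>j\<in>Obj J. \<forall>u\<in>Hom J i j.
       Comp C X (Fobj D i) (Fobj D j) (Farr D i j u) (\<mu> i) = \<mu> j)"

definition is_limit_cone ::
  "('o, 'a) category \<Rightarrow> ('j, 'k) category \<Rightarrow> ('j, 'k, 'o, 'a) ftor \<Rightarrow> 'o \<Rightarrow> ('j \<Rightarrow> 'a) \<Rightarrow> bool" where
  "is_limit_cone C J D L \<kappa> \<longleftrightarrow>
    is_cone C J D L \<kappa> \<and>
    (\<forall>X \<mu>. is_cone C J D X \<mu> \<longrightarrow>
       (\<exists>!h. h \<in> Hom C X L \<and> (\<forall>i\<in>Obj J. Comp C X L (Fobj D i) (\<kappa> i) h = \<mu> i)))"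

definition is_finite_category :: "('j, 'k) category \<Rightarrow> bool" where
  "is_finite_category J \<longleftrightarrow>
    is_category J \<and> finite (Obj J) \<and> (\<forall>i\<in>Obj J. \<forall>j\<in>Obj J. finite (Hom J i j))"

text \<open>Preservation of finite limits; every finite category is isomorphic to one whose objects
  and arrows are natural numbers.\<close>

definition left_exact ::
  "('o, 'a) category \<Rightarrow> ('p, 'b) category \<Rightarrow> ('o, 'a, 'p, 'b) ftor \<Rightarrow> bool" where
  "left_exact C D F \<longleftrightarrow>
    is_functor C D F \<and>
    (\<forall>(J :: (nat, nat) category) K L \<mu>.
       is_finite_category J \<and> is_functor J C K \<and> is_limit_cone C J K L \<mu> \<longrightarrow>
       is_limit_cone D J (F \<circ>\<^sub>F K) (Fobj F L) (\<lambda>i. Farr F L (Fobj K i) (\<mu> i)))"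

text \<open>A geometric morphism \<open>E \<rightarrow> F\<close>: inverse image \<open>invim : F \<rightarrow> E\<close> first, then direct image
  \<open>dirim : E \<rightarrow> F\<close>.\<close>

definition geometric_morphism ::
  "('o, 'a) category \<Rightarrow> ('p, 'b) category \<Rightarrow>
   ('p, 'b, 'o, 'a) ftor \<Rightarrow> ('o, 'a, 'p, 'b) ftor \<Rightarrow> bool" where
  "geometric_morphism E F invim dirim \<longleftrightarrow> adjunction F E invim dirim \<and> left_exact F E invim"

definition essential_geometric_morphism ::
  "('o, 'a) category \<Rightarrow> ('p, 'b) category \<Rightarrow>
   ('o, 'a, 'p, 'b) ftor \<Rightarrow> ('p, 'b, 'o, 'a) ftor \<Rightarrow> ('o, 'a, 'p, 'b) ftor \<Rightarrow> bool" where
  "essential_geometric_morphism E F shriek invim dirim \<longleftrightarrow>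
    geometric_morphism E F invim dirim \<and> adjunction E F shriek invim"

section \<open>The universe of sets\<close>

text \<open>\<open>\<U>\<close> plays the role of the sets of the ambient category Set: the objects of the categories
  of \<open>M\<close>-sets below have their carrier in \<open>\<U>\<close>. Since HOL has no type of all sets, \<open>\<U>\<close> is a family
  of subsets of a type \<open>'u\<close>, and only the closure properties needed to form the adjoints of the
  inverse image functor and of the inclusions are required, relative to the (small) monoid type
  \<open>'m\<close>. They hold for the sets of a Grothendieck universe containing the monoid, but also for
  the family of all subsets of a large enough power type (\<open>set_universe_UNIV\<close> below), so they are
  satisfiable for arbitrary monoids. The first and last clauses force \<open>\<U>\<close> to contain copies of
  the monoid and of its power set.\<close>

definition set_universe :: "'m itself \<Rightarrow> 'u set set \<Rightarrow> bool" where
  "set_universe _ \<U> \<longleftrightarrow>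
    (\<exists>a b. a \<noteq> b \<and> {a, b} \<in> \<U>) \<and>
    (\<forall>X\<in>\<U>. \<forall>Y. Y \<lesssim> X \<longrightarrow> Y \<in> \<U>) \<and>
    (\<forall>X\<in>\<U>. \<forall>Y\<in>\<U>. \<exists>Z\<in>\<U>. X \<times> Y \<approx> Z) \<and>
    (\<forall>X\<in>\<U>. \<exists>Z\<in>\<U>. (UNIV :: 'm set) \<rightarrow>\<^sub>E X \<approx> Z)"

section \<open>Right M-sets\<close>

text \<open>Monoids are types of class \<^class>\<open>monoid_mult\<close>. Actions and equivariant maps are
  normalised to be \<^const>\<open>undefined\<close> outside the carrier, so that equality of objects and arrows
  is the intended one.\<close>

record ('u, 'm) mset =
  pts :: "'u set"
  act :: "'u \<Rightarrow> 'm \<Rightarrow> 'u"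

definition is_mset :: "('u, 'm::monoid_mult) mset \<Rightarrow> bool" where
  "is_mset X \<longleftrightarrow>
    act X \<in> extensional (pts X) \<and>
    (\<forall>x\<in>pts X. \<forall>m. act X x m \<in> pts X) \<and>
    (\<forall>x\<in>pts X. act X x 1 = x) \<and>
    (\<forall>x\<in>pts X. \<forall>m n. act X (act X x m) n = act X x (m * n))"

definition equivariant_maps :: "('u, 'm) mset \<Rightarrow> ('u, 'm) mset \<Rightarrow> ('u \<Rightarrow> 'u) set" where
  "equivariant_maps X Y =
    {h \<in> pts X \<rightarrow>\<^sub>E pts Y. \<forall>x\<in>pts X. \<forall>m. h (act X x m) = act Y (h x) m}"

definition PSh :: "'u set set \<Rightarrow> (('u, 'm::monoid_mult) mset, 'u \<Rightarrow> 'u) category" where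
  "PSh \<U> = \<lparr>Obj = {X. is_mset X \<and> pts X \<in> \<U>},
            Hom = equivariant_maps,
            Idn = (\<lambda>X. \<lambda>x\<in>pts X. x),
            Comp = (\<lambda>X Y Z g h. compose (pts X) g h)\<rparr>"

definition continuous_mset :: "'m topology \<Rightarrow> ('u, 'm) mset \<Rightarrow> bool" where
  "continuous_mset \<tau> X \<longleftrightarrow>
    continuous_map (prod_topology (discrete_topology (pts X)) \<tau>) (discrete_topology (pts X))
      (\<lambda>(x, m). act X x m)"

definition Cont ::
  "'u set set \<Rightarrow> 'm::monoid_mult topology \<Rightarrow> (('u, 'm) mset, 'u \<Rightarrow> 'u) category" where
  "Cont \<U> \<tau> = full_subcategory (PSh \<U>) (continuous_mset \<tau>)"

text \<open>The inverse image functor of a semigroup homomorphism \<open>\<phi>\<close>, where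
  \<open>X \<otimes>\<^bsub>M'\<^esub> M' \<phi>(1)\<close> is identified with \<open>{x \<in> X. x \<phi>(1) = x}\<close>.\<close>

definition inverse_image ::
  "('m::monoid_mult \<Rightarrow> 'n) \<Rightarrow> (('u, 'n) mset, 'u \<Rightarrow> 'u, ('u, 'm) mset, 'u \<Rightarrow> 'u) ftor" where
  "inverse_image \<phi> =
    (let fix = (\<lambda>X. {x \<in> pts X. act X x (\<phi> 1) = x})
     in \<lparr>Fobj = (\<lambda>X. \<lparr>pts = fix X, act = (\<lambda>x\<in>fix X. \<lambda>m. act X x (\<phi> m))\<rparr>),
         Farr = (\<lambda>X Y h. restrict h (fix X))\<rparr>)"

section \<open>The action topology\<close>

definition translate_preimage :: "'m::monoid_mult \<Rightarrow> 'm set \<Rightarrow> 'm set" where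
  "translate_preimage p A = {m. p * m \<in> A}"

definition necessary_clopen :: "'m::monoid_mult \<Rightarrow> 'm set \<Rightarrow> 'm set" where
  "necessary_clopen p A = {m. translate_preimage m A = translate_preimage p A}"

definition action_base :: "'m::monoid_mult topology \<Rightarrow> 'm set set" where
  "action_base \<tau> = {A. \<forall>p q. openin \<tau> (necessary_clopen p (translate_preimage q A))}"

definition action_topology :: "'m::monoid_mult topology \<Rightarrow> 'm topology" where
  "action_topology \<tau> = topology (arbitrary union_of (\<lambda>A. A \<in> action_base \<tau>))"

section \<open>Well-formedness\<close>

lemma set_universe_UNIV:
  assumes inf: "infinite (UNIV :: 'b set)" and le: "(UNIV :: 'm set) \<lesssim> (UNIV :: 'b set)"
  shows "set_universe TYPE('m) (UNIV :: 'b set set set)"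
proof -
  have "(UNIV :: 'b set) \<times> (UNIV :: 'b set) \<approx> (UNIV :: 'b set)"
    unfolding eqpoll_iff_card_of_ordIso using inf by (rule card_of_Times_same_infinite)
  then obtain c :: "'b \<times> 'b \<Rightarrow> 'b" where c: "inj c"
    by (auto simp: eqpoll_def bij_betw_def)
  obtain d :: "'m \<Rightarrow> 'b" where d: "inj d"
    using le by (auto simp: lepoll_def)
  obtain a b :: 'b where ab: "a \<noteq> b"
  proof -
    obtain a :: 'b where True by blast
    have "infinite (UNIV - {a})" using inf by simp
    then have "UNIV - {a} \<noteq> {}" by (metis finite.emptyI)
    with that show thesis by blast
  qed
  have code: "\<exists>Z\<in>(UNIV :: 'b set set set). A \<approx> Z" if f: "inj f" for A :: "'a set" and f :: "'a \<Rightarrow> 'b set"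
    by (rule bexI[OF _ UNIV_I], rule eqpoll_sym[OF inj_on_image_eqpoll_self[OF inj_on_subset[OF f subset_UNIV]]])
  have "inj (\<lambda>(X, Y). (\<lambda>x. c (a, x)) ` X \<union> (\<lambda>y. c (b, y)) ` Y)"
  proof (rule inj_onI, clarify)
    fix X Y X' Y'
    assume e: "(\<lambda>x. c (a, x)) ` X \<union> (\<lambda>y. c (b, y)) ` Y = (\<lambda>x. c (a, x)) ` X' \<union> (\<lambda>y. c (b, y)) ` Y'"
    have "x \<in> X \<longleftrightarrow> x \<in> X'" "y \<in> Y \<longleftrightarrow> y \<in> Y'" for x y
      using arg_cong[OF e, of "\<lambda>S. c (a, x) \<in> S"] arg_cong[OF e, of "\<lambda>S. c (b, y) \<in> S"] ab
      by (auto simp: image_iff inj_eq[OF c])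
    then show "X = X' \<and> Y = Y'" by blast
  qed
  note prod = code[OF this]
  have "inj (\<lambda>F :: 'm \<Rightarrow> 'b set. {c (d m, x) | m x. x \<in> F m})"
  proof (rule inj_onI, rule ext)
    fix F F' :: "'m \<Rightarrow> 'b set" and m
    assume e: "{c (d m, x) | m x. x \<in> F m} = {c (d m, x) | m x. x \<in> F' m}"
    have "x \<in> F m \<longleftrightarrow> x \<in> F' m" for x
      using arg_cong[OF e, of "\<lambda>S. c (d m, x) \<in> S"] by (auto simp: inj_eq[OF c] inj_eq[OF d])
    then show "F m = F' m" by blast
  qed
  note exp = code[OF this]
  have "\<exists>a b :: 'b set. a \<noteq> b" by blast
  then show ?thesis
    unfolding set_universe_def using prod exp by simp
qed

lemma openin_action_topology:
  "openin (action_topology \<tau>) = arbitrary union_of (\<lambda>A. A \<in> action_base \<tau>)"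
proof -
  have "A \<inter> B \<in> action_base \<tau>" if A: "A \<in> action_base \<tau>" and B: "B \<in> action_base \<tau>" for A B
    unfolding action_base_def mem_Collect_eq
  proof (intro allI)
    fix p q
    let ?A = "translate_preimage q A" and ?B = "translate_preimage q B"
    have "necessary_clopen p (translate_preimage q (A \<inter> B))
        = (\<Union>m\<in>necessary_clopen p (translate_preimage q (A \<inter> B)).
             necessary_clopen m ?A \<inter> necessary_clopen m ?B)"
      unfolding necessary_clopen_def translate_preimage_def by blast
    also have "openin \<tau> \<dots>"
      using A B unfolding action_base_def by (intro openin_Union) auto
    finally show "openin \<tau> (necessary_clopen p (translate_preimage q (A \<inter> B)))" .
  qed
  then show ?thesis
    unfolding action_topology_def
    by (intro topology_inverse' istopology_base)
qed

lemma topspace_action_topology: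
  assumes "topspace \<tau> = UNIV"
  shows "topspace (action_topology \<tau>) = UNIV"
proof -
  have "openin \<tau> UNIV"
    using assms by (metis openin_topspace)
  then have "UNIV \<in> action_base \<tau>"
    by (simp add: action_base_def necessary_clopen_def translate_preimage_def)
  then have "openin (action_topology \<tau>) UNIV"
    unfolding openin_action_topology by (rule arbitrary_union_of_inc)
  then show ?thesis
    using openin_subset by blast
qed

lemma is_category_PSh: "is_category (PSh \<U>)"
  unfolding is_category_def PSh_def equivariant_maps_def is_mset_def
  by (auto simp: compose_def PiE_def extensional_def restrict_def fun_eq_iff Pi_def)

lemma is_category_full_subcategory: "is_category C \<Longrightarrow> is_category (full_subcategory C P)"
  unfolding is_category_def full_subcategory_def by auto

lemma is_category_Cont: "is_category (Cont \<U> \<tau>)"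
  unfolding Cont_def by (intro is_category_full_subcategory is_category_PSh)

end

theory Submission
  imports Defs
begin

text \<open>Continuity of \<open>\<phi>\<close> is read off from two families. For \<open>A\<close> in the base of the action topology, the
  translates \<open>q\<^sup>*(A)\<close> form a continuous \<open>M'\<close>-set, and \<open>\<phi>(m) \<in> A\<close> depends only on the orbit map
  of its point \<open>\<phi>(1)\<^sup>*(A)\<close>, which lies in the inverse image; conversely, for a point \<open>x\<close> of a
  continuous \<open>M'\<close>-set, each set \<open>{n. x n = y}\<close> lies in the base.

  As \<open>R' f\<^sub>*\<close> is right adjoint to \<open>f\<^sup>*V'\<close>, if \<open>f\<^sup>*V'\<close> lands in continuous \<open>M\<close>-sets one takes
  \<open>G = R' f\<^sub>*V\<close>, and \<open>G R \<cong> R' f\<^sub>*\<close> because both are right adjoint to \<open>f\<^sup>*V'\<close>. Conversely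
  \<open>G R\<close> is right adjoint to \<open>V R f\<^sup>*V'\<close>, so \<open>G R \<cong> R' f\<^sub>*\<close> makes \<open>f\<^sup>*X\<close> isomorphic to the
  continuous \<open>M\<close>-set \<open>R f\<^sup>*X\<close>.\<close>

section \<open>Categories and adjunctions\<close>

lemma category_idn: "is_category C \<Longrightarrow> X \<in> Obj C \<Longrightarrow> Idn C X \<in> Hom C X X"
  unfolding is_category_def by blast

lemma category_comp:
  "\<lbrakk>is_category C; h \<in> Hom C X Y; g \<in> Hom C Y Z; X \<in> Obj C; Y \<in> Obj C; Z \<in> Obj C\<rbrakk>
    \<Longrightarrow> Comp C X Y Z g h \<in> Hom C X Z"
  unfolding is_category_def by blast

lemma category_idn_right:
  "\<lbrakk>is_category C; h \<in> Hom C X Y; X \<in> Obj C; Y \<in> Obj C\<rbrakk> \<Longrightarrow> Comp C X X Y h (Idn C X) = h"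
  unfolding is_category_def by blast

lemma category_idn_left:
  "\<lbrakk>is_category C; h \<in> Hom C X Y; X \<in> Obj C; Y \<in> Obj C\<rbrakk> \<Longrightarrow> Comp C X Y Y (Idn C Y) h = h"
  unfolding is_category_def by blast

lemma category_assoc:
  "\<lbrakk>is_category C; h \<in> Hom C W X; g \<in> Hom C X Y; k \<in> Hom C Y Z;
    W \<in> Obj C; X \<in> Obj C; Y \<in> Obj C; Z \<in> Obj C\<rbrakk>
    \<Longrightarrow> Comp C W Y Z k (Comp C W X Y g h) = Comp C W X Z (Comp C X Y Z k g) h"
  unfolding is_category_def by blast

lemma functor_obj: "is_functor C D F \<Longrightarrow> X \<in> Obj C \<Longrightarrow> Fobj F X \<in> Obj D"
  unfolding is_functor_def by blast

lemma functor_arr: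
  "\<lbrakk>is_functor C D F; h \<in> Hom C X Y; X \<in> Obj C; Y \<in> Obj C\<rbrakk>
    \<Longrightarrow> Farr F X Y h \<in> Hom D (Fobj F X) (Fobj F Y)"
  unfolding is_functor_def by blast

lemma functor_idn:
  "is_functor C D F \<Longrightarrow> X \<in> Obj C \<Longrightarrow> Farr F X X (Idn C X) = Idn D (Fobj F X)"
  unfolding is_functor_def by blast

lemma functor_comp:
  "\<lbrakk>is_functor C D F; h \<in> Hom C X Y; g \<in> Hom C Y Z; X \<in> Obj C; Y \<in> Obj C; Z \<in> Obj C\<rbrakk>
    \<Longrightarrow> Farr F X Z (Comp C X Y Z g h)
      = Comp D (Fobj F X) (Fobj F Y) (Fobj F Z) (Farr F Y Z g) (Farr F X Y h)"
  unfolding is_functor_def by blast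

lemma comp_functor_simps [simp]:
  "Fobj (G \<circ>\<^sub>F F) X = Fobj G (Fobj F X)"
  "Farr (G \<circ>\<^sub>F F) X Y h = Farr G (Fobj F X) (Fobj F Y) (Farr F X Y h)"
  by (simp_all add: comp_functor_def)

lemma inclusion_functor_simps [simp]:
  "Fobj inclusion_functor X = X" "Farr inclusion_functor X Y h = h"
  by (simp_all add: inclusion_functor_def)

lemma comp_functor_assoc: "G \<circ>\<^sub>F F \<circ>\<^sub>F K = G \<circ>\<^sub>F (F \<circ>\<^sub>F K)"
  by (simp add: comp_functor_def)

lemma inclusion_comp_functor: "inclusion_functor \<circ>\<^sub>F F = (F :: ('o, 'a, 'p, 'b) ftor)"
  by (cases F) (simp add: comp_functor_def)

lemma comp_inclusion_functor: "F \<circ>\<^sub>F inclusion_functor = (F :: ('o, 'a, 'p, 'b) ftor)"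
  by (cases F) (simp add: comp_functor_def)

lemma is_functor_comp:
  assumes "is_functor C D F" "is_functor D E G"
  shows "is_functor C E (G \<circ>\<^sub>F F)"
  using assms unfolding is_functor_def by simp

section \<open>Adjunctions as natural bijections of hom-sets\<close>

text \<open>Naturality is split into one law for each variable, where \<open>adjunction\<close>
  states a single law for both at once. Each half then serves as a rewrite rule for moving an arrow
  through a transpose.\<close>

definition hom_iso ::
  "('o, 'a) category \<Rightarrow> ('p, 'b) category \<Rightarrow> ('o, 'a, 'p, 'b) ftor \<Rightarrow> ('p, 'b, 'o, 'a) ftor
    \<Rightarrow> ('o \<Rightarrow> 'p \<Rightarrow> 'b \<Rightarrow> 'a) \<Rightarrow> bool" where
  "hom_iso C D L R \<Phi> \<longleftrightarrow>
    (\<forall>X\<in>Obj C. \<forall>Y\<in>Obj D. bij_betw (\<Phi> X Y) (Hom D (Fobj L X) Y) (Hom C X (Fobj R Y))) \<and>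
    (\<forall>X\<in>Obj C. \<forall>X'\<in>Obj C. \<forall>Y\<in>Obj D. \<forall>u\<in>Hom C X' X. \<forall>h\<in>Hom D (Fobj L X) Y.
       \<Phi> X' Y (Comp D (Fobj L X') (Fobj L X) Y h (Farr L X' X u))
         = Comp C X' X (Fobj R Y) (\<Phi> X Y h) u) \<and>
    (\<forall>X\<in>Obj C. \<forall>Y\<in>Obj D. \<forall>Y'\<in>Obj D. \<forall>h\<in>Hom D (Fobj L X) Y. \<forall>v\<in>Hom D Y Y'.
       \<Phi> X Y' (Comp D (Fobj L X) Y Y' v h)
         = Comp C X (Fobj R Y) (Fobj R Y') (Farr R Y Y' v) (\<Phi> X Y h))"

lemma hom_iso_bij:
  "hom_iso C D L R \<Phi> \<Longrightarrow> X \<in> Obj C \<Longrightarrow> Y \<in> Obj D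
    \<Longrightarrow> bij_betw (\<Phi> X Y) (Hom D (Fobj L X) Y) (Hom C X (Fobj R Y))"
  unfolding hom_iso_def by blast

lemma hom_iso_mem:
  "hom_iso C D L R \<Phi> \<Longrightarrow> h \<in> Hom D (Fobj L X) Y \<Longrightarrow> X \<in> Obj C \<Longrightarrow> Y \<in> Obj D
    \<Longrightarrow> \<Phi> X Y h \<in> Hom C X (Fobj R Y)"
  by (rule bij_betw_apply[OF hom_iso_bij])

lemma hom_iso_nat_left:
  "\<lbrakk>hom_iso C D L R \<Phi>; u \<in> Hom C X' X; h \<in> Hom D (Fobj L X) Y;
    X \<in> Obj C; X' \<in> Obj C; Y \<in> Obj D\<rbrakk>
    \<Longrightarrow> \<Phi> X' Y (Comp D (Fobj L X') (Fobj L X) Y h (Farr L X' X u))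
      = Comp C X' X (Fobj R Y) (\<Phi> X Y h) u"
  unfolding hom_iso_def by blast

lemma hom_iso_nat_right:
  "\<lbrakk>hom_iso C D L R \<Phi>; h \<in> Hom D (Fobj L X) Y; v \<in> Hom D Y Y';
    X \<in> Obj C; Y \<in> Obj D; Y' \<in> Obj D\<rbrakk>
    \<Longrightarrow> \<Phi> X Y' (Comp D (Fobj L X) Y Y' v h)
      = Comp C X (Fobj R Y) (Fobj R Y') (Farr R Y Y' v) (\<Phi> X Y h)"
  unfolding hom_iso_def by blast

lemma hom_iso_eqI:
  "\<lbrakk>hom_iso C D L R \<Phi>; \<Phi> X Y h = \<Phi> X Y k; h \<in> Hom D (Fobj L X) Y; k \<in> Hom D (Fobj L X) Y;
    X \<in> Obj C; Y \<in> Obj D\<rbrakk> \<Longrightarrow> h = k"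
  using hom_iso_bij[of C D L R \<Phi> X Y] by (auto simp: bij_betw_def inj_on_def)

text \<open>Putting an identity for one of the two arrows in the joint naturality law of
  \<open>adjunction\<close> leaves the law for the other arrow.\<close>

lemma adjunctionE:
  assumes "adjunction C D L R" "is_category C" "is_category D"
  obtains \<Phi> where "is_functor C D L" "is_functor D C R" "hom_iso C D L R \<Phi>"
proof -
  note L = assms(1)[unfolded adjunction_def, THEN conjunct1]
    and R = assms(1)[unfolded adjunction_def, THEN conjunct2, THEN conjunct1]
  obtain \<Phi> where bij: "\<And>X Y. X \<in> Obj C \<Longrightarrow> Y \<in> Obj D
        \<Longrightarrow> bij_betw (\<Phi> X Y) (Hom D (Fobj L X) Y) (Hom C X (Fobj R Y))"
    and nat: "\<And>X X' Y Y' u h v. \<lbrakk>X \<in> Obj C; X' \<in> Obj C; Y \<in> Obj D; Y' \<in> Obj D;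
        u \<in> Hom C X' X; h \<in> Hom D (Fobj L X) Y; v \<in> Hom D Y Y'\<rbrakk>
        \<Longrightarrow> \<Phi> X' Y' (Comp D (Fobj L X') Y Y' v
                        (Comp D (Fobj L X') (Fobj L X) Y h (Farr L X' X u)))
              = Comp C X' (Fobj R Y) (Fobj R Y') (Farr R Y Y' v)
                  (Comp C X' X (Fobj R Y) (\<Phi> X Y h) u)"
    using assms(1) unfolding adjunction_def by metis
  have mem: "\<Phi> X Y h \<in> Hom C X (Fobj R Y)"
    if "h \<in> Hom D (Fobj L X) Y" "X \<in> Obj C" "Y \<in> Obj D" for X Y h
    using bij that bij_betwE by blast
  note [simp] = category_idn[OF assms(2)] category_idn[OF assms(3)]
    category_idn_left[OF assms(2)] category_idn_right[OF assms(2)]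
    category_idn_left[OF assms(3)] category_idn_right[OF assms(3)]
    category_comp[OF assms(2)] category_comp[OF assms(3)]
    functor_obj[OF L] functor_obj[OF R] functor_arr[OF L] functor_arr[OF R]
    functor_idn[OF L] functor_idn[OF R]
  have "hom_iso C D L R \<Phi>"
    unfolding hom_iso_def
  proof (intro conjI ballI bij)
    fix X X' Y u h
    assume a: "X \<in> Obj C" "X' \<in> Obj C" "Y \<in> Obj D" "u \<in> Hom C X' X" "h \<in> Hom D (Fobj L X) Y"
    then show "\<Phi> X' Y (Comp D (Fobj L X') (Fobj L X) Y h (Farr L X' X u))
         = Comp C X' X (Fobj R Y) (\<Phi> X Y h) u"
      using nat[of X X' Y Y u h "Idn D Y"] by (simp add: mem)
  next
    fix X Y Y' h v
    assume a: "X \<in> Obj C" "Y \<in> Obj D" "Y' \<in> Obj D" "h \<in> Hom D (Fobj L X) Y" "v \<in> Hom D Y Y'"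
    then show "\<Phi> X Y' (Comp D (Fobj L X) Y Y' v h)
         = Comp C X (Fobj R Y) (Fobj R Y') (Farr R Y Y' v) (\<Phi> X Y h)"
      using nat[of X X Y Y' "Idn C X" h v] by (simp add: mem)
  qed auto
  with L R that show thesis by blast
qed

lemma adjunctionI:
  assumes L: "is_functor C D L" and R: "is_functor D C R" and \<Phi>: "hom_iso C D L R \<Phi>"
    and "is_category C" and D: "is_category D"
  shows "adjunction C D L R"
  unfolding adjunction_def
proof (intro conjI exI[of _ \<Phi>] ballI L R hom_iso_bij[OF \<Phi>])
  fix X X' Y Y' u h v
  assume a: "X \<in> Obj C" "X' \<in> Obj C" "Y \<in> Obj D" "Y' \<in> Obj D" "u \<in> Hom C X' X"
    "h \<in> Hom D (Fobj L X) Y" "v \<in> Hom D Y Y'"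
  then have "Comp D (Fobj L X') (Fobj L X) Y h (Farr L X' X u) \<in> Hom D (Fobj L X') Y"
    by (simp add: category_comp[OF D] functor_obj[OF L] functor_arr[OF L])
  with a show "\<Phi> X' Y' (Comp D (Fobj L X') Y Y' v
                  (Comp D (Fobj L X') (Fobj L X) Y h (Farr L X' X u)))
        = Comp C X' (Fobj R Y) (Fobj R Y') (Farr R Y Y' v)
            (Comp C X' X (Fobj R Y) (\<Phi> X Y h) u)"
    by (simp add: hom_iso_nat_right[OF \<Phi>] hom_iso_nat_left[OF \<Phi>])
qed auto

text \<open>Transposition across the two adjunctions in turn, from Hom(L'LX, Y) to Hom(LX, R'Y) to
  Hom(X, RR'Y), is a composite of natural bijections.\<close>

lemma adjunction_comp:
  assumes adj: "adjunction C D L R" "adjunction D E L' R'"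
    and cat: "is_category C" "is_category D" "is_category E"
  shows "adjunction C E (L' \<circ>\<^sub>F L) (R \<circ>\<^sub>F R')"
proof -
  obtain \<Phi> where L: "is_functor C D L" and R: "is_functor D C R" and \<Phi>: "hom_iso C D L R \<Phi>"
    using adjunctionE[OF adj(1) cat(1,2)] by blast
  obtain \<Phi>' where L': "is_functor D E L'" and R': "is_functor E D R'"
    and \<Phi>': "hom_iso D E L' R' \<Phi>'"
    using adjunctionE[OF adj(2) cat(2,3)] by blast
  note [simp] = functor_obj[OF L] functor_obj[OF R] functor_obj[OF L'] functor_obj[OF R']
    functor_arr[OF L] functor_arr[OF R] functor_arr[OF L'] functor_arr[OF R']
    hom_iso_mem[OF \<Phi>] hom_iso_mem[OF \<Phi>']
  have "hom_iso C E (L' \<circ>\<^sub>F L) (R \<circ>\<^sub>F R') (\<lambda>X Y h. \<Phi> X (Fobj R' Y) (\<Phi>' (Fobj L X) Y h))"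
    unfolding hom_iso_def
  proof (intro conjI ballI)
    fix X Y assume a: "X \<in> Obj C" "Y \<in> Obj E"
    show "bij_betw (\<lambda>h. \<Phi> X (Fobj R' Y) (\<Phi>' (Fobj L X) Y h))
        (Hom E (Fobj (L' \<circ>\<^sub>F L) X) Y) (Hom C X (Fobj (R \<circ>\<^sub>F R') Y))"
      using bij_betw_trans[OF hom_iso_bij[OF \<Phi>' functor_obj[OF L a(1)] a(2)]
          hom_iso_bij[OF \<Phi> a(1) functor_obj[OF R' a(2)]]]
      by (simp add: comp_def)
  qed (simp_all add: hom_iso_nat_left[OF \<Phi>] hom_iso_nat_left[OF \<Phi>'],
       simp_all add: hom_iso_nat_right[OF \<Phi>] hom_iso_nat_right[OF \<Phi>'])
  then show ?thesis
    by (rule adjunctionI[OF is_functor_comp[OF L L'] is_functor_comp[OF R' R] _ cat(1,3)])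
qed

lemma is_iso_sym:
  assumes "is_iso C X Y h"
  obtains g where "is_iso C Y X g" "Comp C X Y X g h = Idn C X" "Comp C Y X Y h g = Idn C Y"
  using assms unfolding is_iso_def by blast

section \<open>Yoneda arguments and uniqueness of adjoints\<close>

text \<open>A natural map out of a represented functor is determined by the image of the identity,
  so a bijective one is composition with an isomorphism.\<close>

lemma yoneda_iso:
  assumes C: "is_category C" and P: "P \<in> Obj C" and Q: "Q \<in> Obj C"
    and bij: "\<And>X. X \<in> Obj C \<Longrightarrow> bij_betw (\<Psi> X) (Hom C X P) (Hom C X Q)"
    and nat: "\<And>X X' u h. \<lbrakk>X \<in> Obj C; X' \<in> Obj C; u \<in> Hom C X' X; h \<in> Hom C X P\<rbrakk>
      \<Longrightarrow> \<Psi> X' (Comp C X' X P h u) = Comp C X' X Q (\<Psi> X h) u"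
  shows "is_iso C P Q (\<Psi> P (Idn C P))"
proof -
  let ?a = "\<Psi> P (Idn C P)"
  have a: "?a \<in> Hom C P Q"
    by (rule bij_betw_apply[OF bij[OF P] category_idn[OF C P]])
  \<comment> \<open>The inverse is the arrow that \<open>\<Psi> Q\<close> sends to the identity of
    \<open>Q\<close>.\<close>
  obtain b where b: "b \<in> Hom C Q P" "\<Psi> Q b = Idn C Q"
    using bij[OF Q] category_idn[OF C Q] by (metis bij_betw_imp_surj_on imageE)
  have ab: "Comp C Q P Q ?a b = Idn C Q"
    using nat[OF P Q b(1) category_idn[OF C P]] b category_idn_left[OF C b(1) Q P] by simp
  have ba: "Comp C P Q P b ?a \<in> Hom C P P"
    using category_comp[OF C a b(1) P Q P] .
  \<comment> \<open>For the other composite, both sides have the same image under the injective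
    \<open>\<Psi> P\<close>.\<close>
  have "\<Psi> P (Comp C P Q P b ?a) = \<Psi> P (Idn C P)"
    using nat[OF Q P a b(1)] b(2) category_idn_left[OF C a P Q] by simp
  then have "Comp C P Q P b ?a = Idn C P"
    using bij_betw_imp_inj_on[OF bij[OF P]] ba category_idn[OF C P] by (meson inj_onD)
  with a ab b show ?thesis
    unfolding is_iso_def by blast
qed

text \<open>Dual to \<open>yoneda_iso\<close>; covariance in \<open>Y\<close> reverses the
  isomorphism, which runs from \<open>Q\<close> to \<open>P\<close>.\<close>

lemma coyoneda_iso:
  assumes C: "is_category C" and P: "P \<in> Obj C" and Q: "Q \<in> Obj C"
    and bij: "\<And>Y. Y \<in> Obj C \<Longrightarrow> bij_betw (\<Psi> Y) (Hom C P Y) (Hom C Q Y)"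
    and nat: "\<And>Y Y' v h. \<lbrakk>Y \<in> Obj C; Y' \<in> Obj C; v \<in> Hom C Y Y'; h \<in> Hom C P Y\<rbrakk>
      \<Longrightarrow> \<Psi> Y' (Comp C P Y Y' v h) = Comp C Q Y Y' v (\<Psi> Y h)"
  shows "is_iso C Q P (\<Psi> P (Idn C P))"
proof -
  let ?a = "\<Psi> P (Idn C P)"
  have a: "?a \<in> Hom C Q P"
    by (rule bij_betw_apply[OF bij[OF P] category_idn[OF C P]])
  obtain b where b: "b \<in> Hom C P Q" "\<Psi> Q b = Idn C Q"
    using bij[OF Q] category_idn[OF C Q] by (metis bij_betw_imp_surj_on imageE)
  have ba: "Comp C Q P Q b ?a = Idn C Q"
    using nat[OF P Q b(1) category_idn[OF C P]] b category_idn_right[OF C b(1) P Q] by simp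
  have ab: "Comp C P Q P ?a b \<in> Hom C P P"
    using category_comp[OF C b(1) a P Q P] .
  have "\<Psi> P (Comp C P Q P ?a b) = \<Psi> P (Idn C P)"
    using nat[OF Q P a b(1)] b(2) category_idn_right[OF C a Q P] by simp
  then have "Comp C P Q P ?a b = Idn C P"
    using bij_betw_imp_inj_on[OF bij[OF P]] ab category_idn[OF C P] by (meson inj_onD)
  with a ba b show ?thesis
    unfolding is_iso_def by blast
qed

text \<open>Inverse transposition for \<open>R\<close> followed by transposition for
  \<open>R'\<close> is a natural bijection from arrows into \<open>R Y\<close> to arrows into
  \<open>R' Y\<close>, which Yoneda turns into isomorphisms natural in \<open>Y\<close>.\<close>

lemma right_adjoint_unique:
  assumes adj: "adjunction C D L R" "adjunction C D L R'"
    and cat: "is_category C" "is_category D"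
  shows "nat_iso D C R R'"
proof -
  obtain \<Phi> where L: "is_functor C D L" and R: "is_functor D C R" and \<Phi>: "hom_iso C D L R \<Phi>"
    using adjunctionE[OF adj(1) cat] by blast
  obtain \<Phi>' where R': "is_functor D C R'" and \<Phi>': "hom_iso C D L R' \<Phi>'"
    using adjunctionE[OF adj(2) cat] by blast
  define \<Psi> where "\<Psi> X Y k = \<Phi>' X Y (inv_into (Hom D (Fobj L X) Y) (\<Phi> X Y) k)" for X Y k
  have \<Psi>: "\<Psi> X Y (\<Phi> X Y h) = \<Phi>' X Y h"
    if "X \<in> Obj C" "Y \<in> Obj D" "h \<in> Hom D (Fobj L X) Y" for X Y h
    using bij_betw_inv_into_left[OF hom_iso_bij[OF \<Phi>]] that unfolding \<Psi>_def by simp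
  have bij: "bij_betw (\<Psi> X Y) (Hom C X (Fobj R Y)) (Hom C X (Fobj R' Y))"
    if "X \<in> Obj C" "Y \<in> Obj D" for X Y
    using bij_betw_trans[OF bij_betw_inv_into[OF hom_iso_bij[OF \<Phi> that]] hom_iso_bij[OF \<Phi>' that]]
    unfolding \<Psi>_def comp_def .
  \<comment> \<open>Every arrow into \<open>R Y\<close> is a transpose, so naturality of
    \<open>\<Psi>\<close> can be checked on arrows of the form \<open>\<Phi> X Y h\<close>.\<close>
  have rep: "\<exists>h\<in>Hom D (Fobj L X) Y. k = \<Phi> X Y h"
    if "k \<in> Hom C X (Fobj R Y)" "X \<in> Obj C" "Y \<in> Obj D" for X Y k
    using hom_iso_bij[OF \<Phi> that(2,3)] that(1) by (metis bij_betw_imp_surj_on imageE)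
  note [simp] = functor_obj[OF L] functor_obj[OF R] functor_obj[OF R']
    functor_arr[OF L] functor_arr[OF R] category_comp[OF cat(1)] category_comp[OF cat(2)]
    category_idn[OF cat(1)]
  have natl: "\<Psi> X' Y (Comp C X' X (Fobj R Y) k u) = Comp C X' X (Fobj R' Y) (\<Psi> X Y k) u"
    if "X \<in> Obj C" "X' \<in> Obj C" "Y \<in> Obj D" "u \<in> Hom C X' X" "k \<in> Hom C X (Fobj R Y)"
    for X X' Y u k
    using rep[OF that(5,1,3)] that
    by (auto simp: \<Psi> hom_iso_nat_left[OF \<Phi>, symmetric] hom_iso_nat_left[OF \<Phi>', symmetric])
  have natr: "\<Psi> X Y' (Comp C X (Fobj R Y) (Fobj R Y') (Farr R Y Y' v) k)
      = Comp C X (Fobj R' Y) (Fobj R' Y') (Farr R' Y Y' v) (\<Psi> X Y k)"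
    if "X \<in> Obj C" "Y \<in> Obj D" "Y' \<in> Obj D" "v \<in> Hom D Y Y'" "k \<in> Hom C X (Fobj R Y)"
    for X Y Y' v k
    using rep[OF that(5,1,2)] that
    by (auto simp: \<Psi> hom_iso_nat_right[OF \<Phi>, symmetric] hom_iso_nat_right[OF \<Phi>', symmetric])
  show ?thesis
    unfolding nat_iso_def
  proof (intro exI[of _ "\<lambda>Y. \<Psi> (Fobj R Y) Y (Idn C (Fobj R Y))"] conjI ballI)
    fix Y assume "Y \<in> Obj D"
    then show "is_iso C (Fobj R Y) (Fobj R' Y) (\<Psi> (Fobj R Y) Y (Idn C (Fobj R Y)))"
      by (intro yoneda_iso[OF cat(1), where \<Psi> = "\<lambda>X. \<Psi> X Y"] bij natl) simp_all
  next
    fix Y Y' v assume a: "Y \<in> Obj D" "Y' \<in> Obj D" "v \<in> Hom D Y Y'"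
    \<comment> \<open>Both ways around the naturality square equal the image under
      \<open>\<Psi>\<close> of \<open>Farr R Y Y' v\<close>.\<close>
    have "\<Psi> (Fobj R Y) Y' (Farr R Y Y' v)
        = Comp C (Fobj R Y) (Fobj R Y') (Fobj R' Y') (\<Psi> (Fobj R Y') Y' (Idn C (Fobj R Y'))) (Farr R Y Y' v)"
      using natl[of "Fobj R Y'" "Fobj R Y" Y' "Farr R Y Y' v" "Idn C (Fobj R Y')"] a
      by (simp add: category_idn_left[OF cat(1)])
    moreover have "\<Psi> (Fobj R Y) Y' (Farr R Y Y' v)
        = Comp C (Fobj R Y) (Fobj R' Y) (Fobj R' Y') (Farr R' Y Y' v) (\<Psi> (Fobj R Y) Y (Idn C (Fobj R Y)))"
      using natr[of "Fobj R Y" Y Y' v "Idn C (Fobj R Y)"] a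
      by (simp add: category_idn_right[OF cat(1)])
    ultimately show "Comp C (Fobj R Y) (Fobj R Y') (Fobj R' Y') (\<Psi> (Fobj R Y') Y' (Idn C (Fobj R Y'))) (Farr R Y Y' v)
        = Comp C (Fobj R Y) (Fobj R' Y) (Fobj R' Y') (Farr R' Y Y' v) (\<Psi> (Fobj R Y) Y (Idn C (Fobj R Y)))"
      by simp
  qed
qed

text \<open>For a fixed \<open>X\<close>, transposing through \<open>L\<close>, moving along the
  isomorphism of right adjoints and transposing back through \<open>L'\<close> is a bijection
  natural in \<open>Y\<close>. One isomorphism for each object is enough to transfer continuity, so
  nothing is claimed about naturality in \<open>X\<close>.\<close>

lemma left_adjoint_unique:
  assumes adj: "adjunction C D L R" "adjunction C D L' R'"
    and iso: "nat_iso D C R R'"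
    and cat: "is_category C" "is_category D" and X: "X \<in> Obj C"
  shows "\<exists>h. is_iso D (Fobj L' X) (Fobj L X) h"
proof -
  obtain \<Phi> where L: "is_functor C D L" and R: "is_functor D C R" and \<Phi>: "hom_iso C D L R \<Phi>"
    using adjunctionE[OF adj(1) cat] by blast
  obtain \<Phi>' where L': "is_functor C D L'" and R': "is_functor D C R'" and \<Phi>': "hom_iso C D L' R' \<Phi>'"
    using adjunctionE[OF adj(2) cat] by blast
  obtain \<alpha> where \<alpha>: "\<And>Y. Y \<in> Obj D \<Longrightarrow> is_iso C (Fobj R Y) (Fobj R' Y) (\<alpha> Y)"
    and nat\<alpha>: "\<And>Y Y' v. \<lbrakk>Y \<in> Obj D; Y' \<in> Obj D; v \<in> Hom D Y Y'\<rbrakk> \<Longrightarrow>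
      Comp C (Fobj R Y) (Fobj R Y') (Fobj R' Y') (\<alpha> Y') (Farr R Y Y' v)
        = Comp C (Fobj R Y) (Fobj R' Y) (Fobj R' Y') (Farr R' Y Y' v) (\<alpha> Y)"
    using iso unfolding nat_iso_def by blast
  note [simp] = functor_obj[OF L] functor_obj[OF R] functor_obj[OF L'] functor_obj[OF R']
    functor_arr[OF R] functor_arr[OF R'] category_comp[OF cat(1)] category_comp[OF cat(2)]
    hom_iso_mem[OF \<Phi>] hom_iso_mem[OF \<Phi>']
  have \<alpha>mem [simp]: "\<alpha> Y \<in> Hom C (Fobj R Y) (Fobj R' Y)" if "Y \<in> Obj D" for Y
    using \<alpha>[OF that] unfolding is_iso_def by blast
  define T where "T Y k = Comp C X (Fobj R Y) (Fobj R' Y) (\<alpha> Y) k" for Y k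
  have T: "bij_betw (T Y) (Hom C X (Fobj R Y)) (Hom C X (Fobj R' Y))" if Y: "Y \<in> Obj D" for Y
  proof -
    obtain g where g: "is_iso C (Fobj R' Y) (Fobj R Y) g"
      "Comp C (Fobj R Y) (Fobj R' Y) (Fobj R Y) g (\<alpha> Y) = Idn C (Fobj R Y)"
      "Comp C (Fobj R' Y) (Fobj R Y) (Fobj R' Y) (\<alpha> Y) g = Idn C (Fobj R' Y)"
      using is_iso_sym[OF \<alpha>[OF Y]] by blast
    then have gm: "g \<in> Hom C (Fobj R' Y) (Fobj R Y)"
      unfolding is_iso_def by blast
    show ?thesis
      by (rule bij_betw_byWitness[where f' = "\<lambda>k. Comp C X (Fobj R' Y) (Fobj R Y) g k"])
        (use X Y gm in \<open>auto simp: T_def category_assoc[OF cat(1)] g category_idn_left[OF cat(1)]\<close>)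
  qed
  define \<Psi> where "\<Psi> Y h = inv_into (Hom D (Fobj L' X) Y) (\<Phi>' X Y) (T Y (\<Phi> X Y h))" for Y h
  have bij: "bij_betw (\<Psi> Y) (Hom D (Fobj L X) Y) (Hom D (Fobj L' X) Y)" if Y: "Y \<in> Obj D" for Y
    using bij_betw_trans[OF bij_betw_trans[OF hom_iso_bij[OF \<Phi> X Y] T[OF Y]]
        bij_betw_inv_into[OF hom_iso_bij[OF \<Phi>' X Y]]]
    unfolding \<Psi>_def comp_def .
  have \<Psi>: "\<Phi>' X Y (\<Psi> Y h) = T Y (\<Phi> X Y h)" if "Y \<in> Obj D" "h \<in> Hom D (Fobj L X) Y" for Y h
    unfolding \<Psi>_def
    using bij_betw_inv_into_right[OF hom_iso_bij[OF \<Phi>' X that(1)]] that X by (simp add: T_def)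
  have \<Psi>mem: "\<Psi> Y h \<in> Hom D (Fobj L' X) Y" if "Y \<in> Obj D" "h \<in> Hom D (Fobj L X) Y" for Y h
    using that by (rule bij_betw_apply[OF bij])
  \<comment> \<open>\<open>\<Psi>\<close> is defined by an inverse of \<open>\<Phi>'\<close>, so the
    two sides are compared after applying \<open>\<Phi>'\<close>, which is injective.\<close>
  have "\<Psi> Y' (Comp D (Fobj L X) Y Y' v h) = Comp D (Fobj L' X) Y Y' v (\<Psi> Y h)"
    if a: "Y \<in> Obj D" "Y' \<in> Obj D" "v \<in> Hom D Y Y'" "h \<in> Hom D (Fobj L X) Y" for Y Y' v h
  proof (rule hom_iso_eqI[OF \<Phi>'])
    have "\<Phi>' X Y' (\<Psi> Y' (Comp D (Fobj L X) Y Y' v h))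
        = Comp C X (Fobj R Y') (Fobj R' Y') (\<alpha> Y')
            (Comp C X (Fobj R Y) (Fobj R Y') (Farr R Y Y' v) (\<Phi> X Y h))"
      using a X by (simp add: \<Psi> T_def hom_iso_nat_right[OF \<Phi>])
    also have "\<dots> = Comp C X (Fobj R' Y) (Fobj R' Y') (Farr R' Y Y' v) (T Y (\<Phi> X Y h))"
      using a X by (simp add: T_def category_assoc[OF cat(1)] nat\<alpha>)
    also have "\<dots> = \<Phi>' X Y' (Comp D (Fobj L' X) Y Y' v (\<Psi> Y h))"
      using a X by (simp add: \<Psi> \<Psi>mem hom_iso_nat_right[OF \<Phi>'])
    finally show "\<Phi>' X Y' (\<Psi> Y' (Comp D (Fobj L X) Y Y' v h))
        = \<Phi>' X Y' (Comp D (Fobj L' X) Y Y' v (\<Psi> Y h))" .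
  qed (use a X \<Psi>mem in simp_all)
  then have "is_iso D (Fobj L' X) (Fobj L X) (\<Psi> (Fobj L X) (Idn D (Fobj L X)))"
    using X by (intro coyoneda_iso[OF cat(2)] bij) simp_all
  then show ?thesis by blast
qed

text \<open>Precomposition with the components of the isomorphism carries Hom(L'X, Y) to Hom(LX, Y).
  This is how the adjunction for \<open>inverse_image \<phi>\<close> passes to
  \<open>R \<circ>\<^sub>F inverse_image \<phi>\<close>.\<close>

lemma adjunction_nat_iso_left:
  assumes adj: "adjunction C D L R" and L': "is_functor C D L'" and iso: "nat_iso C D L L'"
    and cat: "is_category C" "is_category D"
  shows "adjunction C D L' R"
proof -
  obtain \<Phi> where L: "is_functor C D L" and R: "is_functor D C R" and \<Phi>: "hom_iso C D L R \<Phi>"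
    using adjunctionE[OF adj cat] by blast
  obtain \<alpha> where \<alpha>: "\<And>X. X \<in> Obj C \<Longrightarrow> is_iso D (Fobj L X) (Fobj L' X) (\<alpha> X)"
    and nat\<alpha>: "\<And>X X' u. \<lbrakk>X \<in> Obj C; X' \<in> Obj C; u \<in> Hom C X' X\<rbrakk> \<Longrightarrow>
      Comp D (Fobj L X') (Fobj L X) (Fobj L' X) (\<alpha> X) (Farr L X' X u)
        = Comp D (Fobj L X') (Fobj L' X') (Fobj L' X) (Farr L' X' X u) (\<alpha> X')"
    using iso unfolding nat_iso_def by blast
  note [simp] = functor_obj[OF L] functor_obj[OF R] functor_obj[OF L']
    functor_arr[OF L] functor_arr[OF R] functor_arr[OF L']
    category_comp[OF cat(1)] category_comp[OF cat(2)] hom_iso_mem[OF \<Phi>]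
  have \<alpha>mem [simp]: "\<alpha> X \<in> Hom D (Fobj L X) (Fobj L' X)" if "X \<in> Obj C" for X
    using \<alpha>[OF that] unfolding is_iso_def by blast
  define T where "T X Y h = Comp D (Fobj L X) (Fobj L' X) Y h (\<alpha> X)" for X Y h
  have T: "bij_betw (T X Y) (Hom D (Fobj L' X) Y) (Hom D (Fobj L X) Y)"
    if X: "X \<in> Obj C" and Y: "Y \<in> Obj D" for X Y
  proof -
    obtain g where g: "is_iso D (Fobj L' X) (Fobj L X) g"
      "Comp D (Fobj L X) (Fobj L' X) (Fobj L X) g (\<alpha> X) = Idn D (Fobj L X)"
      "Comp D (Fobj L' X) (Fobj L X) (Fobj L' X) (\<alpha> X) g = Idn D (Fobj L' X)"
      using is_iso_sym[OF \<alpha>[OF X]] by blast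
    then have gm: "g \<in> Hom D (Fobj L' X) (Fobj L X)"
      unfolding is_iso_def by blast
    show ?thesis
      by (rule bij_betw_byWitness[where f' = "\<lambda>k. Comp D (Fobj L' X) (Fobj L X) Y k g"])
        (use X Y gm in \<open>auto simp: T_def category_assoc[OF cat(2), symmetric] g
          category_idn_right[OF cat(2)]\<close>)
  qed
  have "hom_iso C D L' R (\<lambda>X Y h. \<Phi> X Y (T X Y h))"
    unfolding hom_iso_def
  proof (intro conjI ballI)
    fix X Y assume a: "X \<in> Obj C" "Y \<in> Obj D"
    show "bij_betw (\<lambda>h. \<Phi> X Y (T X Y h)) (Hom D (Fobj L' X) Y) (Hom C X (Fobj R Y))"
      using bij_betw_trans[OF T hom_iso_bij[OF \<Phi>]] a by (simp add: comp_def)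
  next
    fix X X' Y u h
    assume a: "X \<in> Obj C" "X' \<in> Obj C" "Y \<in> Obj D" "u \<in> Hom C X' X" "h \<in> Hom D (Fobj L' X) Y"
    have "T X' Y (Comp D (Fobj L' X') (Fobj L' X) Y h (Farr L' X' X u))
        = Comp D (Fobj L X') (Fobj L X) Y (T X Y h) (Farr L X' X u)"
      using a by (simp add: T_def category_assoc[OF cat(2), symmetric] nat\<alpha>)
    with a show "\<Phi> X' Y (T X' Y (Comp D (Fobj L' X') (Fobj L' X) Y h (Farr L' X' X u)))
        = Comp C X' X (Fobj R Y) (\<Phi> X Y (T X Y h)) u"
      by (simp add: hom_iso_nat_left[OF \<Phi>] T_def)
  next
    fix X Y Y' h v
    assume a: "X \<in> Obj C" "Y \<in> Obj D" "Y' \<in> Obj D" "h \<in> Hom D (Fobj L' X) Y" "v \<in> Hom D Y Y'"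
    have "T X Y' (Comp D (Fobj L' X) Y Y' v h) = Comp D (Fobj L X) Y Y' v (T X Y h)"
      using a by (simp add: T_def category_assoc[OF cat(2)])
    with a show "\<Phi> X Y' (T X Y' (Comp D (Fobj L' X) Y Y' v h))
        = Comp C X (Fobj R Y) (Fobj R Y') (Farr R Y Y' v) (\<Phi> X Y (T X Y h))"
      by (simp add: hom_iso_nat_right[OF \<Phi>] T_def)
  qed
  then show ?thesis
    by (rule adjunctionI[OF L' R _ cat])
qed

section \<open>Left exactness and limits under right adjoints\<close>

lemma left_exact_comp:
  assumes "left_exact C D F" "left_exact D E G"
  shows "left_exact C E (G \<circ>\<^sub>F F)"
  unfolding left_exact_def
proof (intro conjI allI impI)
  show "is_functor C E (G \<circ>\<^sub>F F)"
    using assms is_functor_comp unfolding left_exact_def by blast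
next
  fix J :: "(nat, nat) category" and K P \<mu>
  assume a: "is_finite_category J \<and> is_functor J C K \<and> is_limit_cone C J K P \<mu>"
  then have "is_functor J D (F \<circ>\<^sub>F K)"
      "is_limit_cone D J (F \<circ>\<^sub>F K) (Fobj F P) (\<lambda>i. Farr F P (Fobj K i) (\<mu> i))"
    using assms(1) is_functor_comp unfolding left_exact_def by blast+
  with a assms(2) have "is_limit_cone E J (G \<circ>\<^sub>F (F \<circ>\<^sub>F K)) (Fobj G (Fobj F P))
      (\<lambda>i. Farr G (Fobj F P) (Fobj (F \<circ>\<^sub>F K) i) (Farr F P (Fobj K i) (\<mu> i)))"
    unfolding left_exact_def by blast
  then show "is_limit_cone E J (G \<circ>\<^sub>F F \<circ>\<^sub>F K) (Fobj (G \<circ>\<^sub>F F) P)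
      (\<lambda>i. Farr (G \<circ>\<^sub>F F) P (Fobj K i) (\<mu> i))"
    by (simp add: comp_functor_assoc)
qed

text \<open>A cone from \<open>X\<close> over the image diagram transposes to a cone from
  \<open>L X\<close> over \<open>K\<close>, and mediating arrows correspond under the same
  transposition.\<close>

lemma right_adjoint_preserves_limit:
  assumes adj: "adjunction C D L R" and cat: "is_category C" "is_category D"
    and K: "is_functor J D K" and lim: "is_limit_cone D J K P \<kappa>"
  shows "is_limit_cone C J (R \<circ>\<^sub>F K) (Fobj R P) (\<lambda>i. Farr R P (Fobj K i) (\<kappa> i))"
proof -
  obtain \<Phi> where L: "is_functor C D L" and R: "is_functor D C R" and \<Phi>: "hom_iso C D L R \<Phi>"
    using adjunctionE[OF adj cat] by blast
  have P: "P \<in> Obj D" and \<kappa>: "\<And>i. i \<in> Obj J \<Longrightarrow> \<kappa> i \<in> Hom D P (Fobj K i)"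
    and cone: "\<And>i j u. \<lbrakk>i \<in> Obj J; j \<in> Obj J; u \<in> Hom J i j\<rbrakk>
       \<Longrightarrow> Comp D P (Fobj K i) (Fobj K j) (Farr K i j u) (\<kappa> i) = \<kappa> j"
    and univ: "\<And>X \<mu>. is_cone D J K X \<mu> \<Longrightarrow>
       \<exists>!h. h \<in> Hom D X P \<and> (\<forall>i\<in>Obj J. Comp D X P (Fobj K i) (\<kappa> i) h = \<mu> i)"
    using lim unfolding is_limit_cone_def is_cone_def[of D J K P \<kappa>] by blast+
  note [simp] = functor_obj[OF L] functor_obj[OF R] functor_obj[OF K]
    functor_arr[OF L] functor_arr[OF R] functor_arr[OF K]
    category_comp[OF cat(1)] category_comp[OF cat(2)] hom_iso_mem[OF \<Phi>] P \<kappa>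
  show ?thesis
    unfolding is_limit_cone_def
  proof (intro conjI allI impI)
    show "is_cone C J (R \<circ>\<^sub>F K) (Fobj R P) (\<lambda>i. Farr R P (Fobj K i) (\<kappa> i))"
      unfolding is_cone_def by (simp add: functor_comp[OF R, symmetric] cone)
  next
    fix X \<mu> assume cone': "is_cone C J (R \<circ>\<^sub>F K) X \<mu>"
    then have X [simp]: "X \<in> Obj C"
      and \<mu>: "\<And>i. i \<in> Obj J \<Longrightarrow> \<mu> i \<in> Hom C X (Fobj R (Fobj K i))"
      and \<mu>cone: "\<And>i j u. \<lbrakk>i \<in> Obj J; j \<in> Obj J; u \<in> Hom J i j\<rbrakk> \<Longrightarrow>
        Comp C X (Fobj R (Fobj K i)) (Fobj R (Fobj K j)) (Farr R (Fobj K i) (Fobj K j) (Farr K i j u)) (\<mu> i) = \<mu> j"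
      unfolding is_cone_def by auto
    have "\<forall>i\<in>Obj J. \<exists>n\<in>Hom D (Fobj L X) (Fobj K i). \<Phi> X (Fobj K i) n = \<mu> i"
      using \<mu> hom_iso_bij[OF \<Phi> X] by (metis bij_betw_imp_surj_on functor_obj[OF K] imageE)
    then obtain \<nu> where \<nu> [simp]: "\<And>i. i \<in> Obj J \<Longrightarrow> \<nu> i \<in> Hom D (Fobj L X) (Fobj K i)"
      and \<Phi>\<nu> [simp]: "\<And>i. i \<in> Obj J \<Longrightarrow> \<Phi> X (Fobj K i) (\<nu> i) = \<mu> i"
      by metis
    \<comment> \<open>The transposed legs form a cone because the two sides of each cone equation
      have equal transposes.\<close>
    have "is_cone D J K (Fobj L X) \<nu>"
      unfolding is_cone_def
    proof (intro conjI ballI)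
      fix i j u assume "i \<in> Obj J" "j \<in> Obj J" "u \<in> Hom J i j"
      then show "Comp D (Fobj L X) (Fobj K i) (Fobj K j) (Farr K i j u) (\<nu> i) = \<nu> j"
        by (intro hom_iso_eqI[OF \<Phi>, of X "Fobj K j"]) (simp_all add: hom_iso_nat_right[OF \<Phi>] \<mu>cone)
    qed simp_all
    then have ex1: "\<exists>!h. h \<in> Hom D (Fobj L X) P
        \<and> (\<forall>i\<in>Obj J. Comp D (Fobj L X) P (Fobj K i) (\<kappa> i) h = \<nu> i)"
      by (rule univ)
    \<comment> \<open>Unique existence passes along the bijection \<open>\<Phi> X P\<close> because
      it matches the mediating arrows of the two cones.\<close>
    have transpose: "(\<forall>i\<in>Obj J. Comp C X (Fobj R P) (Fobj R (Fobj K i)) (Farr R P (Fobj K i) (\<kappa> i)) (\<Phi> X P h) = \<mu> i)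
        \<longleftrightarrow> (\<forall>i\<in>Obj J. Comp D (Fobj L X) P (Fobj K i) (\<kappa> i) h = \<nu> i)"
      if "h \<in> Hom D (Fobj L X) P" for h
    proof (intro ball_cong refl)
      fix i assume "i \<in> Obj J"
      with that show "(Comp C X (Fobj R P) (Fobj R (Fobj K i)) (Farr R P (Fobj K i) (\<kappa> i)) (\<Phi> X P h) = \<mu> i)
        \<longleftrightarrow> (Comp D (Fobj L X) P (Fobj K i) (\<kappa> i) h = \<nu> i)"
        using hom_iso_eqI[OF \<Phi>, of X "Fobj K i" "Comp D (Fobj L X) P (Fobj K i) (\<kappa> i) h" "\<nu> i"]
        by (auto simp: hom_iso_nat_right[OF \<Phi>, symmetric])
    qed
    have "\<exists>!k. k \<in> Hom C X (Fobj R P) \<and>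
        (\<forall>i\<in>Obj J. Comp C X (Fobj R P) (Fobj R (Fobj K i)) (Farr R P (Fobj K i) (\<kappa> i)) k = \<mu> i)"
    proof -
      obtain h where h: "h \<in> Hom D (Fobj L X) P"
        "\<forall>i\<in>Obj J. Comp D (Fobj L X) P (Fobj K i) (\<kappa> i) h = \<nu> i"
        using ex1 by blast
      show ?thesis
      proof (rule ex1I[of _ "\<Phi> X P h"])
        fix k assume k: "k \<in> Hom C X (Fobj R P) \<and>
          (\<forall>i\<in>Obj J. Comp C X (Fobj R P) (Fobj R (Fobj K i)) (Farr R P (Fobj K i) (\<kappa> i)) k = \<mu> i)"
        then obtain h' where "h' \<in> Hom D (Fobj L X) P" "k = \<Phi> X P h'"
          using hom_iso_bij[OF \<Phi> X P] by (metis bij_betw_imp_surj_on imageE)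
        with k ex1 h transpose show "k = \<Phi> X P h" by blast
      qed (use h transpose in simp)
    qed
    then show "\<exists>!k. k \<in> Hom C X (Fobj R P) \<and>
        (\<forall>i\<in>Obj J. Comp C X (Fobj R P) (Fobj (R \<circ>\<^sub>F K) i) (Farr R P (Fobj K i) (\<kappa> i)) k = \<mu> i)"
      by simp
  qed
qed

lemma left_exact_right_adjoint:
  assumes "adjunction C D L R" "is_category C" "is_category D"
  shows "left_exact D C R"
  using assms right_adjoint_preserves_limit[OF assms] unfolding left_exact_def adjunction_def by blast

lemma nat_iso_whisker:
  assumes iso: "nat_iso C D G H" and F: "is_functor B C F"
  shows "nat_iso B D (G \<circ>\<^sub>F F) (H \<circ>\<^sub>F F)"
proof -
  obtain \<alpha> where \<alpha>: "\<And>X. X \<in> Obj C \<Longrightarrow> is_iso D (Fobj G X) (Fobj H X) (\<alpha> X)"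
    and nat: "\<And>X Y h. \<lbrakk>X \<in> Obj C; Y \<in> Obj C; h \<in> Hom C X Y\<rbrakk> \<Longrightarrow>
      Comp D (Fobj G X) (Fobj G Y) (Fobj H Y) (\<alpha> Y) (Farr G X Y h)
        = Comp D (Fobj G X) (Fobj H X) (Fobj H Y) (Farr H X Y h) (\<alpha> X)"
    using iso unfolding nat_iso_def by blast
  show ?thesis
    unfolding nat_iso_def
    by (rule exI[of _ "\<lambda>X. \<alpha> (Fobj F X)"]) (simp add: \<alpha> nat functor_obj[OF F] functor_arr[OF F])
qed

section \<open>Full subcategories and coreflections\<close>

lemma full_subcategory_simps [simp]:
  "Obj (full_subcategory C P) = {X \<in> Obj C. P X}" "Hom (full_subcategory C P) = Hom C"
  "Idn (full_subcategory C P) = Idn C" "Comp (full_subcategory C P) = Comp C"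
  by (simp_all add: full_subcategory_def)

lemma is_functor_full_subcategory:
  assumes "is_functor C D F" and "\<And>X. X \<in> Obj C \<Longrightarrow> P (Fobj F X)"
  shows "is_functor C (full_subcategory D P) F"
  using assms unfolding is_functor_def by simp

lemma is_functor_full_subcategory_dom:
  assumes "is_functor D C F"
  shows "is_functor (full_subcategory D P) C F"
  using assms unfolding is_functor_def by simp

text \<open>The hom-sets of a full subcategory are those of \<open>D\<close>, so the same
  \<open>\<Phi>\<close> works. Once \<open>inverse_image \<phi>\<close> lands in the continuous
  M-sets, this yields the right adjoint \<open>G\<close>.\<close>

lemma adjunction_full_subcategory:
  assumes adj: "adjunction C D L R" and cat: "is_category C" "is_category D"
    and P: "\<And>X. X \<in> Obj C \<Longrightarrow> P (Fobj L X)"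
  shows "adjunction C (full_subcategory D P) L R"
proof -
  obtain \<Phi> where L: "is_functor C D L" and R: "is_functor D C R" and \<Phi>: "hom_iso C D L R \<Phi>"
    using adjunctionE[OF adj cat] by blast
  have "hom_iso C (full_subcategory D P) L R \<Phi>"
    using \<Phi> unfolding hom_iso_def by simp
  moreover have "is_functor C (full_subcategory D P) L"
    using is_functor_full_subcategory[OF L] P by blast
  ultimately show ?thesis
    by (intro adjunctionI[OF _ is_functor_full_subcategory_dom[OF R] _
          cat(1) is_category_full_subcategory[OF cat(2)]])
qed

text \<open>For \<open>Y\<close> already in the subcategory, transposition is a natural bijection
  from arrows into \<open>Y\<close> to arrows into \<open>R Y\<close>, both taken in the
  subcategory. By Yoneda the transpose of the identity, which is the unit of the adjunction, is
  invertible.\<close>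

lemma coreflection_unit_iso:
  assumes adj: "adjunction (full_subcategory D P) D inclusion_functor R" and D: "is_category D"
  shows "nat_iso (full_subcategory D P) (full_subcategory D P) inclusion_functor R"
proof -
  let ?C = "full_subcategory D P"
  have C: "is_category ?C"
    using D by (rule is_category_full_subcategory)
  obtain \<Phi> where R: "is_functor D ?C R" and \<Phi>: "hom_iso ?C D inclusion_functor R \<Phi>"
    using adjunctionE[OF adj C D] by blast
  have sub: "X \<in> Obj D" if "X \<in> Obj ?C" for X
    using that by simp
  have bij: "bij_betw (\<Phi> X Y) (Hom ?C X Y) (Hom ?C X (Fobj R Y))"
    if "X \<in> Obj ?C" "Y \<in> Obj ?C" for X Y
    using hom_iso_bij[OF \<Phi> that(1) sub[OF that(2)]] by simp
  have natl: "\<Phi> X' Y (Comp ?C X' X Y h u) = Comp ?C X' X (Fobj R Y) (\<Phi> X Y h) u"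
    if "X \<in> Obj ?C" "X' \<in> Obj ?C" "Y \<in> Obj ?C" "u \<in> Hom ?C X' X" "h \<in> Hom ?C X Y" for X X' Y u h
    using hom_iso_nat_left[OF \<Phi>, of u X' X h Y] that by simp
  have natr: "\<Phi> X Y' (Comp ?C X Y Y' v h)
      = Comp ?C X (Fobj R Y) (Fobj R Y') (Farr R Y Y' v) (\<Phi> X Y h)"
    if "X \<in> Obj ?C" "Y \<in> Obj ?C" "Y' \<in> Obj ?C" "h \<in> Hom ?C X Y" "v \<in> Hom ?C Y Y'" for X Y Y' v h
    using hom_iso_nat_right[OF \<Phi>, of h X Y v Y'] that by simp
  show ?thesis
    unfolding nat_iso_def
  proof (intro exI[of _ "\<lambda>Y. \<Phi> Y Y (Idn ?C Y)"] conjI ballI)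
    fix Y assume Y: "Y \<in> Obj ?C"
    have "is_iso ?C Y (Fobj R Y) (\<Phi> Y Y (Idn ?C Y))"
      by (rule yoneda_iso[OF C Y functor_obj[OF R sub[OF Y]] bij[OF _ Y] natl[OF _ _ Y]])
    then show "is_iso ?C (Fobj inclusion_functor Y) (Fobj R Y) (\<Phi> Y Y (Idn ?C Y))"
      by simp
  next
    fix X Y h assume a: "X \<in> Obj ?C" "Y \<in> Obj ?C" "h \<in> Hom ?C X Y"
    \<comment> \<open>Both ways around the naturality square equal the transpose
      \<open>\<Phi> X Y h\<close>.\<close>
    have "Comp ?C X Y (Fobj R Y) (\<Phi> Y Y (Idn ?C Y)) h = \<Phi> X Y h"
      using natl[OF a(2,1,2,3) category_idn[OF C a(2)]] category_idn_left[OF C a(3,1,2)] by simp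
    also have "\<Phi> X Y h = Comp ?C X (Fobj R X) (Fobj R Y) (Farr R X Y h) (\<Phi> X X (Idn ?C X))"
      using natr[OF a(1,1,2) category_idn[OF C a(1)] a(3)] category_idn_right[OF C a(3,1,2)] by simp
    finally show "Comp ?C (Fobj inclusion_functor X) (Fobj inclusion_functor Y) (Fobj R Y)
          (\<Phi> Y Y (Idn ?C Y)) (Farr inclusion_functor X Y h)
        = Comp ?C (Fobj inclusion_functor X) (Fobj R X) (Fobj R Y) (Farr R X Y h) (\<Phi> X X (Idn ?C X))"
      by simp
  qed
qed

section \<open>Continuous M-sets\<close>

lemma PSh_simps [simp]:
  "Obj (PSh \<U>) = {X. is_mset X \<and> pts X \<in> \<U>}" "Hom (PSh \<U>) = equivariant_maps"
  "Idn (PSh \<U>) X = (\<lambda>x\<in>pts X. x)" "Comp (PSh \<U>) X Y Z g h = compose (pts X) g h"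
  by (simp_all add: PSh_def)

lemma Cont_simps [simp]:
  "Obj (Cont \<U> \<tau>) = {X. is_mset X \<and> pts X \<in> \<U> \<and> continuous_mset \<tau> X}"
  "Hom (Cont \<U> \<tau>) = equivariant_maps"
  "Idn (Cont \<U> \<tau>) X = (\<lambda>x\<in>pts X. x)" "Comp (Cont \<U> \<tau>) X Y Z g h = compose (pts X) g h"
  by (auto simp: Cont_def)

lemma is_msetD:
  assumes "is_mset X" "x \<in> pts X"
  shows "act X x m \<in> pts X" "act X x 1 = x" "act X (act X x m) n = act X x (m * n)"
  using assms unfolding is_mset_def by auto

lemma equivariant_mapsD:
  assumes "h \<in> equivariant_maps X Y" "x \<in> pts X"
  shows "h x \<in> pts Y" "h (act X x m) = act Y (h x) m"
  using assms unfolding equivariant_maps_def by auto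

lemma equivariant_maps_eqI:
  assumes "h \<in> equivariant_maps X Y" "k \<in> equivariant_maps X Y" "\<And>x. x \<in> pts X \<Longrightarrow> h x = k x"
  shows "h = k"
  using assms unfolding equivariant_maps_def by (auto intro: PiE_ext)

text \<open>As the points carry the discrete topology, joint continuity splits into one orbit map
  for each point, and a map into a discrete space is tested on single values.\<close>

lemma continuous_mset_iff:
  assumes X: "is_mset X" and \<tau>: "topspace \<tau> = UNIV"
  shows "continuous_mset \<tau> X \<longleftrightarrow> (\<forall>x\<in>pts X. \<forall>y. openin \<tau> {m. act X x m = y})"
proof
  assume cont: "continuous_mset \<tau> X"
  show "\<forall>x\<in>pts X. \<forall>y. openin \<tau> {m. act X x m = y}"
  proof (intro ballI allI)
    fix x y assume x: "x \<in> pts X"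
    have "continuous_map \<tau> (prod_topology (discrete_topology (pts X)) \<tau>) (\<lambda>m. (x, m))"
      using x by (intro continuous_map_pairedI) simp_all
    then have "continuous_map \<tau> (discrete_topology (pts X)) (\<lambda>m. act X x m)"
      using continuous_map_compose cont unfolding continuous_mset_def by (fastforce simp: comp_def)
    \<comment> \<open>\<open>y\<close> is arbitrary, so \<open>{y}\<close> is met with the carrier
      to obtain an open set of the discrete topology on \<open>pts X\<close>.\<close>
    then have "openin \<tau> {m \<in> topspace \<tau>. act X x m \<in> {y} \<inter> pts X}"
      by (rule openin_continuous_map_preimage) simp
    moreover have "{m \<in> topspace \<tau>. act X x m \<in> {y} \<inter> pts X} = {m. act X x m = y}"
      using is_msetD[OF X x] \<tau> by auto
    ultimately show "openin \<tau> {m. act X x m = y}" by simp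
  qed
next
  assume op: "\<forall>x\<in>pts X. \<forall>y. openin \<tau> {m. act X x m = y}"
  show "continuous_mset \<tau> X"
    unfolding continuous_mset_def continuous_map_def
  proof (intro conjI allI impI)
    show "(\<lambda>(x, m). act X x m) \<in> topspace (prod_topology (discrete_topology (pts X)) \<tau>)
        \<rightarrow> topspace (discrete_topology (pts X))"
      using is_msetD[OF X] by auto
    fix U
    \<comment> \<open>The preimage of \<open>U\<close> is a union of rectangles, one for each point
      of the carrier and each value in \<open>U\<close>.\<close>
    have "{z \<in> topspace (prod_topology (discrete_topology (pts X)) \<tau>). (case z of (x, m) \<Rightarrow> act X x m) \<in> U}
        = (\<Union>x\<in>pts X. \<Union>y\<in>U. {x} \<times> {m. act X x m = y})"
      using \<tau> by auto
    also have "openin (prod_topology (discrete_topology (pts X)) \<tau>) \<dots>"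
      using op by (intro openin_Union) (auto simp: openin_prod_Times_iff)
    finally show "openin (prod_topology (discrete_topology (pts X)) \<tau>)
      {z \<in> topspace (prod_topology (discrete_topology (pts X)) \<tau>). (case z of (x, m) \<Rightarrow> act X x m) \<in> U}" .
  qed
qed

text \<open>An injective equivariant map identifies orbit fibres of \<open>X\<close> with orbit
  fibres of \<open>Y\<close>. It transports continuity back along the isomorphism from an inverse
  image to a continuous M-set.\<close>

lemma continuous_mset_inj:
  assumes X: "is_mset X" and Y: "is_mset Y" "continuous_mset \<tau> Y" and \<tau>: "topspace \<tau> = UNIV"
    and h: "h \<in> equivariant_maps X Y" "inj_on h (pts X)"
  shows "continuous_mset \<tau> X"
  unfolding continuous_mset_iff[OF X \<tau>]
proof (intro ballI allI)
  fix x y assume x: "x \<in> pts X"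
  show "openin \<tau> {m. act X x m = y}"
  proof (cases "y \<in> pts X")
    case True
    have "act X x m = y \<longleftrightarrow> act Y (h x) m = h y" for m
      using True is_msetD(1)[OF X x, of m] equivariant_mapsD[OF h(1) x] h(2)
      by (metis inj_onD)
    then show ?thesis
      using Y(2) equivariant_mapsD(1)[OF h(1) x] unfolding continuous_mset_iff[OF Y(1) \<tau>] by simp
  next
    case False
    then have "{m. act X x m = y} = {}"
      using is_msetD(1)[OF X x] by blast
    then show ?thesis by simp
  qed
qed

text \<open>\<open>E\<close> is the quotient of \<open>X\<close> by the joint kernel of finitely many maps into continuous M-sets,
  realised on a set of representatives so that its carrier stays in the universe.\<close>

lemma continuous_joint_image:
  fixes \<nu> :: "'i \<Rightarrow> 'u \<Rightarrow> 'u" and X :: "('u, 'm::monoid_mult) mset"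
  assumes X: "is_mset X" and fin: "finite I" and \<tau>: "topspace \<tau> = UNIV"
    and Y: "\<And>i. i \<in> I \<Longrightarrow> is_mset (Y i)" "\<And>i. i \<in> I \<Longrightarrow> continuous_mset \<tau> (Y i)"
    and \<nu>: "\<And>i. i \<in> I \<Longrightarrow> \<nu> i \<in> equivariant_maps X (Y i)"
  obtains E e where "is_mset E" "continuous_mset \<tau> E" "pts E \<subseteq> pts X" "e \<in> equivariant_maps X E"
    "\<And>x. x \<in> pts E \<Longrightarrow> e x = x" "\<And>x i. x \<in> pts X \<Longrightarrow> i \<in> I \<Longrightarrow> \<nu> i (e x) = \<nu> i x"
proof -
  \<comment> \<open>The choice depends on \<open>x\<close> only through the values
    \<open>\<nu> i x\<close>, so \<open>e\<close> picks one representative of each class of the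
    joint kernel.\<close>
  define e where "e = (\<lambda>x\<in>pts X. SOME y. y \<in> pts X \<and> (\<forall>i\<in>I. \<nu> i y = \<nu> i x))"
  have "e x \<in> pts X \<and> (\<forall>i\<in>I. \<nu> i (e x) = \<nu> i x)" if "x \<in> pts X" for x
    using someI[of "\<lambda>y. y \<in> pts X \<and> (\<forall>i\<in>I. \<nu> i y = \<nu> i x)" x] that by (simp add: e_def)
  then have ein: "e x \<in> pts X" and \<nu>e: "i \<in> I \<Longrightarrow> \<nu> i (e x) = \<nu> i x" if "x \<in> pts X" for x i
    using that by blast+
  have e_eq: "e x = e y \<longleftrightarrow> (\<forall>i\<in>I. \<nu> i x = \<nu> i y)" if "x \<in> pts X" "y \<in> pts X" for x y
  proof
    assume "e x = e y"
    then show "\<forall>i\<in>I. \<nu> i x = \<nu> i y" using \<nu>e that by metis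
  next
    assume "\<forall>i\<in>I. \<nu> i x = \<nu> i y"
    then show "e x = e y" using that unfolding e_def by simp
  qed
  have e_idem: "e (e x) = e x" if "x \<in> pts X" for x
    using e_eq[OF ein[OF that] that] \<nu>e[OF that] by blast
  have \<nu>act: "\<nu> i (act X x m) = act (Y i) (\<nu> i x) m" if "i \<in> I" "x \<in> pts X" for i x m
    using equivariant_mapsD(2)[OF \<nu>] that by blast
  have e_act: "e (act X (e x) m) = e (act X x m)" if "x \<in> pts X" for x m
    using that by (subst e_eq) (simp_all add: is_msetD[OF X] ein \<nu>act \<nu>e)
  define E where "E = \<lparr>pts = e ` pts X, act = (\<lambda>x\<in>e ` pts X. \<lambda>m. e (act X x m))\<rparr>"
  have actE: "act E (e x) m = e (act X x m)" if "x \<in> pts X" for x m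
    using that by (simp add: E_def e_act)
  have ptsE: "pts E = e ` pts X"
    by (simp add: E_def)
  have E: "is_mset E"
    unfolding is_mset_def ptsE
    by (auto simp: actE is_msetD[OF X]) (simp add: E_def)
  have "continuous_mset \<tau> E"
    unfolding continuous_mset_iff[OF E \<tau>] ptsE
  proof (intro ballI allI)
    fix y z assume "y \<in> e ` pts X"
    then obtain x where x: "x \<in> pts X" "y = e x" by blast
    show "openin \<tau> {m. act E y m = z}"
    proof (cases "z \<in> e ` pts X")
      case True
      then obtain w where w: "w \<in> pts X" "z = e w" by blast
      \<comment> \<open>An orbit fibre of \<open>E\<close> is an intersection of orbit fibres of the
        \<open>Y i\<close>, and finiteness of \<open>I\<close> keeps it open. The factor
        \<open>topspace \<tau>\<close> gives the open set when \<open>I\<close> is empty.\<close>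
      have "{m. act E y m = z} = topspace \<tau> \<inter> (\<Inter>i\<in>I. {m. act (Y i) (\<nu> i x) m = \<nu> i w})"
        using x w \<tau> by (auto simp: actE e_eq is_msetD[OF X] \<nu>act)
      also have "openin \<tau> \<dots>"
      proof (cases "I = {}")
        case False
        then show ?thesis
          using fin Y \<nu> x equivariant_mapsD(1) continuous_mset_iff[OF _ \<tau>]
          by (intro openin_Int openin_Inter) fastforce+
      qed simp
      finally show ?thesis .
    next
      case False
      then have "{m. act E y m = z} = {}"
        using x actE is_msetD(1)[OF X] by blast
      then show ?thesis by simp
    qed
  qed
  moreover have "e \<in> equivariant_maps X E"
    unfolding equivariant_maps_def using actE by (auto simp: ptsE) (simp add: e_def)
  moreover have "pts E \<subseteq> pts X" "\<And>x. x \<in> pts E \<Longrightarrow> e x = x"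
    using ein e_idem by (auto simp: ptsE)
  ultimately show thesis
    using that E \<nu>e by blast
qed

text \<open>A map constant on the classes of \<open>e\<close> factors through the quotient; since
  \<open>E\<close> consists of representatives, the factor is the plain restriction.\<close>

lemma restrict_equivariant:
  assumes X: "is_mset X" and E: "is_mset E" and e: "e \<in> equivariant_maps X E" and sub: "pts E \<subseteq> pts X"
    and ret: "\<And>x. x \<in> pts E \<Longrightarrow> e x = x"
    and h: "h \<in> equivariant_maps X Y" "\<And>x. x \<in> pts X \<Longrightarrow> h (e x) = h x"
  shows "restrict h (pts E) \<in> equivariant_maps E Y"
proof -
  have "h (act E x m) = act Y (h x) m" if "x \<in> pts E" for x m
  proof -
    \<comment> \<open>\<open>E\<close> need not be closed under the action of \<open>X\<close>; its
      own action returns to the representative by \<open>e\<close>.\<close>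
    have "act E x m = e (act X x m)"
      using equivariant_mapsD(2)[OF e] ret that sub by (metis subsetD)
    then show ?thesis
      using h equivariant_mapsD(2)[OF h(1)] is_msetD(1)[OF X] that sub by (metis subsetD)
  qed
  moreover have "h x \<in> pts Y" if "x \<in> pts E" for x
    using equivariant_mapsD(1)[OF h(1)] that sub by blast
  ultimately show ?thesis
    unfolding equivariant_maps_def using is_msetD(1)[OF E] by simp
qed

section \<open>Finite limits of continuous M-sets\<close>

lemma set_universe_subset:
  assumes "set_universe TYPE('m) \<U>" "X \<in> \<U>" "Y \<subseteq> X"
  shows "Y \<in> \<U>"
  using assms subset_imp_lepoll unfolding set_universe_def by blast

text \<open>A cone from an arbitrary M-set has its legs in continuous M-sets, so it factors through
  a continuous quotient, where the universal property in \<open>Cont\<close> applies. Having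
  finitely many legs keeps the orbit fibres of that quotient open.\<close>

lemma Cont_limit_cone:
  fixes \<tau> :: "'m::monoid_mult topology"
  assumes univ: "set_universe TYPE('m) \<U>" and \<tau>: "topspace \<tau> = UNIV" and fin: "finite (Obj J)"
    and K: "is_functor J (Cont \<U> \<tau>) K" and lim: "is_limit_cone (Cont \<U> \<tau>) J K P \<kappa>"
  shows "is_limit_cone (PSh \<U>) J K P \<kappa>"
proof -
  have P: "is_mset P" "pts P \<in> \<U>" "continuous_mset \<tau> P"
    and \<kappa>: "\<And>i. i \<in> Obj J \<Longrightarrow> \<kappa> i \<in> equivariant_maps P (Fobj K i)"
    and lim_univ: "\<And>X \<mu>. is_cone (Cont \<U> \<tau>) J K X \<mu> \<Longrightarrow>
      \<exists>!h. h \<in> equivariant_maps X P \<and> (\<forall>i\<in>Obj J. compose (pts X) (\<kappa> i) h = \<mu> i)"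
    using lim unfolding is_limit_cone_def is_cone_def[of _ J K P \<kappa>] by auto
  have Ki: "is_mset (Fobj K i)" "continuous_mset \<tau> (Fobj K i)" if "i \<in> Obj J" for i
    using functor_obj[OF K that] by auto
  show ?thesis
    unfolding is_limit_cone_def
  proof (intro conjI allI impI)
    show "is_cone (PSh \<U>) J K P \<kappa>"
      using lim unfolding is_limit_cone_def is_cone_def[of _ J K P \<kappa>] by simp
  next
    fix X \<mu> assume cone: "is_cone (PSh \<U>) J K X \<mu>"
    then have X: "is_mset X" "pts X \<in> \<U>" and \<mu>: "\<And>i. i \<in> Obj J \<Longrightarrow> \<mu> i \<in> equivariant_maps X (Fobj K i)"
      and \<mu>cone: "\<And>i j u. \<lbrakk>i \<in> Obj J; j \<in> Obj J; u \<in> Hom J i j\<rbrakk> \<Longrightarrow>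
        compose (pts X) (Farr K i j u) (\<mu> i) = \<mu> j"
      unfolding is_cone_def by auto
    \<comment> \<open>Existence and uniqueness of the mediating arrow both descend the cone to a
      continuous quotient, but to different ones.\<close>
    have cone_restrict: "is_cone (Cont \<U> \<tau>) J K E (\<lambda>i. restrict (\<mu> i) (pts E))"
      if E: "is_mset E" "continuous_mset \<tau> E" "pts E \<subseteq> pts X" and e: "e \<in> equivariant_maps X E"
        "\<And>x. x \<in> pts E \<Longrightarrow> e x = x" "\<And>x i. x \<in> pts X \<Longrightarrow> i \<in> Obj J \<Longrightarrow> \<mu> i (e x) = \<mu> i x" for E e
      unfolding is_cone_def
    proof (intro conjI ballI)
      show "E \<in> Obj (Cont \<U> \<tau>)"
        using E set_universe_subset[OF univ X(2)] by simp
    next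
      fix i assume "i \<in> Obj J"
      then show "restrict (\<mu> i) (pts E) \<in> Hom (Cont \<U> \<tau>) E (Fobj K i)"
        using restrict_equivariant[OF X(1) E(1) e(1) E(3) e(2) \<mu>] e(3) by simp
    next
      fix i j u assume "i \<in> Obj J" "j \<in> Obj J" "u \<in> Hom J i j"
      from \<mu>cone[OF this] have "Farr K i j u (\<mu> i x) = \<mu> j x" if "x \<in> pts E" for x
        using that E(3) compose_eq subsetD by metis
      then show "Comp (Cont \<U> \<tau>) E (Fobj K i) (Fobj K j) (Farr K i j u) (restrict (\<mu> i) (pts E))
          = restrict (\<mu> j) (pts E)"
        by (auto simp: compose_def fun_eq_iff)
    qed
    have "\<exists>!h. h \<in> equivariant_maps X P \<and> (\<forall>i\<in>Obj J. compose (pts X) (\<kappa> i) h = \<mu> i)"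
    proof (rule ex_ex1I)
      \<comment> \<open>For existence the quotient is by the joint kernel of all legs
        \<open>\<mu> i\<close>.\<close>
      obtain E e where E: "is_mset E" "continuous_mset \<tau> E" "pts E \<subseteq> pts X" "e \<in> equivariant_maps X E"
        "\<And>x. x \<in> pts E \<Longrightarrow> e x = x" "\<And>x i. x \<in> pts X \<Longrightarrow> i \<in> Obj J \<Longrightarrow> \<mu> i (e x) = \<mu> i x"
        using continuous_joint_image[OF X(1) fin \<tau>, of "Fobj K" \<mu>] Ki \<mu> by blast
      obtain h where h: "h \<in> equivariant_maps E P"
        and \<kappa>h: "\<And>i. i \<in> Obj J \<Longrightarrow> compose (pts E) (\<kappa> i) h = restrict (\<mu> i) (pts E)"
        using lim_univ[OF cone_restrict[OF E]] by blast
      have hE: "\<kappa> i (h x) = \<mu> i x" if "x \<in> pts E" "i \<in> Obj J" for x i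
        using \<kappa>h[OF that(2)] that(1) by (metis compose_eq restrict_apply')
      \<comment> \<open>Composition is taken in \<open>PSh UNIV\<close>, where carriers satisfy the
        universe condition trivially.\<close>
      have "compose (pts X) h e \<in> equivariant_maps X P"
        using category_comp[OF is_category_PSh[of UNIV], of e X E h P] h E(1,4) X(1) P(1) by simp
      moreover have "compose (pts X) (\<kappa> i) (compose (pts X) h e) = \<mu> i" if "i \<in> Obj J" for i
      proof
        fix x show "compose (pts X) (\<kappa> i) (compose (pts X) h e) x = \<mu> i x"
        proof (cases "x \<in> pts X")
          case True
          then show ?thesis
            using hE[OF equivariant_mapsD(1)[OF E(4)] that] E(6) that by (simp add: compose_eq)
        next
          case False
          then show ?thesis
            using \<mu>[OF that] by (auto simp: compose_def equivariant_maps_def PiE_def extensional_def)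
        qed
      qed
      ultimately show "\<exists>h. h \<in> equivariant_maps X P \<and> (\<forall>i\<in>Obj J. compose (pts X) (\<kappa> i) h = \<mu> i)"
        by blast
    next
      \<comment> \<open>\<open>X\<close> need not be continuous, but \<open>h\<close> and \<open>k\<close> both factor through a continuous quotient of it.\<close>
      fix h k
      assume h: "h \<in> equivariant_maps X P \<and> (\<forall>i\<in>Obj J. compose (pts X) (\<kappa> i) h = \<mu> i)"
        and k: "k \<in> equivariant_maps X P \<and> (\<forall>i\<in>Obj J. compose (pts X) (\<kappa> i) k = \<mu> i)"
      have \<kappa>h: "\<kappa> i (h x) = \<mu> i x" "\<kappa> i (k x) = \<mu> i x" if "x \<in> pts X" "i \<in> Obj J" for x i
        using h k that by (metis compose_eq)+
      obtain E e where E: "is_mset E" "continuous_mset \<tau> E" "pts E \<subseteq> pts X" and e: "e \<in> equivariant_maps X E"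
        "\<And>x. x \<in> pts E \<Longrightarrow> e x = x" "\<And>x g. x \<in> pts X \<Longrightarrow> g \<in> {h, k} \<Longrightarrow> g (e x) = g x"
        using continuous_joint_image[OF X(1) _ \<tau>, of "{h, k}" "\<lambda>_. P" "\<lambda>g. g"] P h k by blast
      have ein: "e x \<in> pts E" "e x \<in> pts X" if "x \<in> pts X" for x
        using equivariant_mapsD(1)[OF e(1) that] E(3) by auto
      \<comment> \<open>Each leg factors through \<open>h\<close>, so it is constant on the classes
        of the quotient by \<open>h\<close> and \<open>k\<close>.\<close>
      have "\<mu> i (e x) = \<mu> i x" if "x \<in> pts X" "i \<in> Obj J" for x i
        using \<kappa>h(1)[OF that] \<kappa>h(1)[OF ein(2)[OF that(1)] that(2)] e(3)[OF that(1), of h] by simp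
      then have ex1: "\<exists>!g. g \<in> equivariant_maps E P
          \<and> (\<forall>i\<in>Obj J. compose (pts E) (\<kappa> i) g = restrict (\<mu> i) (pts E))"
        by (intro lim_univ cone_restrict[OF E e(1,2)])
      have "restrict g (pts E) \<in> equivariant_maps E P
          \<and> (\<forall>i\<in>Obj J. compose (pts E) (\<kappa> i) (restrict g (pts E)) = restrict (\<mu> i) (pts E))"
        if "g \<in> {h, k}" for g
      proof (intro conjI ballI)
        show "restrict g (pts E) \<in> equivariant_maps E P"
          using restrict_equivariant[OF X(1) E(1) e(1) E(3) e(2), of g P] e(3) h k that by blast
        fix i assume "i \<in> Obj J"
        then show "compose (pts E) (\<kappa> i) (restrict g (pts E)) = restrict (\<mu> i) (pts E)"
          using that \<kappa>h E(3) by (auto simp: compose_def fun_eq_iff)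
      qed
      then have "restrict h (pts E) = restrict k (pts E)"
        using ex1 by blast
      then have "h (e x) = k (e x)" if "x \<in> pts X" for x
        using ein(1)[OF that] by (metis restrict_apply')
      then have "h x = k x" if "x \<in> pts X" for x
        using e(3)[OF that, of h] e(3)[OF that, of k] that by simp
      then show "h = k"
        using h k equivariant_maps_eqI by blast
    qed
    then show "\<exists>!h. h \<in> Hom (PSh \<U>) X P \<and> (\<forall>i\<in>Obj J. Comp (PSh \<U>) X P (Fobj K i) (\<kappa> i) h = \<mu> i)"
      by simp
  qed
qed

lemma left_exact_Cont_inclusion:
  fixes \<tau> :: "'m::monoid_mult topology"
  assumes "set_universe TYPE('m) \<U>" "topspace \<tau> = UNIV"
  shows "left_exact (Cont \<U> \<tau>) (PSh \<U>) inclusion_functor"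
  using Cont_limit_cone[OF assms]
  unfolding left_exact_def is_finite_category_def inclusion_comp_functor
  by (auto simp: is_functor_def)

section \<open>The inverse image functor and the action topology\<close>

lemma inverse_image_simps [simp]:
  "pts (Fobj (inverse_image \<phi>) X) = {x \<in> pts X. act X x (\<phi> 1) = x}"
  "x \<in> pts X \<Longrightarrow> act X x (\<phi> 1) = x \<Longrightarrow> act (Fobj (inverse_image \<phi>) X) x m = act X x (\<phi> m)"
  by (simp_all add: inverse_image_def Let_def)

section \<open>Translates of a set as points of an M-set\<close>

lemma translate_preimage_translate_preimage:
  "translate_preimage m (translate_preimage q A) = translate_preimage (q * m) A"
  by (simp add: translate_preimage_def mult.assoc)

text \<open>Points of an M-set live in \<open>'u\<close>, so sets of monoid elements need names
  there. The exponential of a two-element set in \<open>\<U>\<close> provides them through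
  characteristic functions.\<close>

lemma set_universe_powerset:
  assumes "set_universe TYPE('m) \<U>"
  obtains e :: "'m set \<Rightarrow> 'u" where "inj e" "range e \<in> (\<U> :: 'u set set)"
proof -
  obtain a b :: 'u where ab: "a \<noteq> b" "{a, b} \<in> \<U>"
    using assms unfolding set_universe_def by blast
  then obtain Z where Z: "Z \<in> \<U>" "(UNIV :: 'm set) \<rightarrow>\<^sub>E {a, b} \<approx> Z"
    using assms unfolding set_universe_def by blast
  then obtain c where c: "bij_betw c ((UNIV :: 'm set) \<rightarrow>\<^sub>E {a, b}) Z"
    unfolding eqpoll_def by blast
  define e where "e B = c (\<lambda>n. if n \<in> B then a else b)" for B :: "'m set"
  have char: "(\<lambda>n. if n \<in> B then a else b) \<in> (UNIV :: 'm set) \<rightarrow>\<^sub>E {a, b}" for B :: "'m set"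
    by auto
  have "inj e"
  proof (rule injI)
    fix A B assume "e A = e B"
    then have "(\<lambda>n. if n \<in> A then a else b) = (\<lambda>n. if n \<in> B then a else b)"
      unfolding e_def using inj_onD[OF bij_betw_imp_inj_on[OF c] _ char char] by blast
    then show "A = B"
      using ab(1) by (metis subsetI subset_antisym)
  qed
  moreover have "range e \<subseteq> Z"
    unfolding e_def using bij_betw_apply[OF c char] by blast
  ultimately show thesis
    using that set_universe_subset[OF assms Z(1)] by blast
qed

text \<open>The monoid acts on the translates of \<open>A\<close> by right multiplication of the
  index, and each orbit fibre is empty or a \<open>necessary_clopen\<close> set of a translate.
  Membership of \<open>A\<close> in the base therefore makes the action continuous.\<close>

lemma translates_mset:
  fixes \<tau> :: "'n::monoid_mult topology" and e :: "'n set \<Rightarrow> 'u"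
  assumes e: "inj e" and A: "A \<in> action_base \<tau>" and \<tau>: "topspace \<tau> = UNIV"
  obtains X where "is_mset X" "continuous_mset \<tau> X" "pts X = (\<lambda>q. e (translate_preimage q A)) ` UNIV"
    "\<And>q m. act X (e (translate_preimage q A)) m = e (translate_preimage (q * m) A)"
proof -
  define S where "S = (\<lambda>q. e (translate_preimage q A)) ` UNIV"
  \<comment> \<open>\<open>e\<close> names a translate by a point and \<open>inv e\<close> recovers
    the set from its name.\<close>
  define X where "X = \<lparr>pts = S, act = (\<lambda>x\<in>S. \<lambda>m. e (translate_preimage m (inv e x)))\<rparr>"
  have pts: "pts X = S"
    by (simp add: X_def)
  have act: "act X (e (translate_preimage q A)) m = e (translate_preimage (q * m) A)" for q m
    by (simp add: X_def S_def inv_f_f[OF e] translate_preimage_translate_preimage)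
  have X: "is_mset X"
    unfolding is_mset_def pts
    by (auto simp: S_def act mult.assoc) (simp add: X_def S_def)
  have "continuous_mset \<tau> X"
    unfolding continuous_mset_iff[OF X \<tau>] pts
  proof (intro ballI allI)
    fix x y assume "x \<in> S"
    then obtain q where q: "x = e (translate_preimage q A)"
      unfolding S_def by blast
    \<comment> \<open>Any element of a nonempty fibre can serve as \<open>p\<close>.\<close>
    have "{m. act X x m = y} = {} \<or> (\<exists>p. {m. act X x m = y} = necessary_clopen p (translate_preimage q A))"
      by (auto simp: q act inj_eq[OF e] necessary_clopen_def translate_preimage_translate_preimage)
    then show "openin \<tau> {m. act X x m = y}"
      using A unfolding action_base_def by auto
  qed
  with X act pts that show thesis
    unfolding S_def by blast
qed

section \<open>Continuity of \<phi> and continuity of inverse images\<close>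

text \<open>The inverse image acts through \<phi>, so its orbit fibres are preimages under \<phi> of
  orbit fibres of \<open>X\<close>, and these belong to the base of the action topology.\<close>

lemma continuous_inverse_image:
  fixes \<phi> :: "'m::monoid_mult \<Rightarrow> 'n::monoid_mult" and X :: "('u, 'n) mset"
  assumes \<phi>: "continuous_map \<tau> (action_topology \<tau>') \<phi>"
    and \<tau>: "topspace \<tau> = UNIV" "topspace \<tau>' = UNIV"
    and X: "is_mset X" "continuous_mset \<tau>' X" and f: "is_mset (Fobj (inverse_image \<phi>) X)"
  shows "continuous_mset \<tau> (Fobj (inverse_image \<phi>) X)"
  unfolding continuous_mset_iff[OF f \<tau>(1)]
proof (intro ballI allI)
  fix x y assume "x \<in> pts (Fobj (inverse_image \<phi>) X)"
  then have x: "x \<in> pts X" "act X x (\<phi> 1) = x" by auto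
  let ?A = "{n. act X x n = y}"
  have "?A \<in> action_base \<tau>'"
    unfolding action_base_def mem_Collect_eq
  proof (intro allI)
    fix p q
    let ?I = "necessary_clopen p (translate_preimage q ?A)"
    \<comment> \<open>Elements that move \<open>act X x q\<close> to the same point give the same
      translate of \<open>translate_preimage q ?A\<close>. Hence \<open>?I\<close> is a union of
      orbit fibres of \<open>act X x q\<close>, each of them open.\<close>
    have "n \<in> ?I" if "m \<in> ?I" "act X (act X x q) n = act X (act X x q) m" for m n
    proof -
      have "act X x (q * (n * k)) = act X x (q * (m * k))" for k
        using that(2) is_msetD[OF X(1)] x(1) by (metis mult.assoc)
      then show ?thesis
        using that(1) by (auto simp: necessary_clopen_def translate_preimage_def)
    qed
    then have "?I = (\<Union>m\<in>?I. {n. act X (act X x q) n = act X (act X x q) m})"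
      by blast
    also have "openin \<tau>' \<dots>"
      using X(2) is_msetD(1)[OF X(1) x(1)] unfolding continuous_mset_iff[OF X(1) \<tau>(2)]
      by (intro openin_Union) auto
    finally show "openin \<tau>' ?I" .
  qed
  then have "openin (action_topology \<tau>') ?A"
    unfolding openin_action_topology by (rule arbitrary_union_of_inc)
  then have "openin \<tau> {m \<in> topspace \<tau>. \<phi> m \<in> ?A}"
    by (rule openin_continuous_map_preimage[OF \<phi>])
  then show "openin \<tau> {m. act (Fobj (inverse_image \<phi>) X) x m = y}"
    using x \<tau>(1) by simp
qed

text \<open>The assumption is applied to the M-set of translates of one base set \<open>A\<close>;
  the preimage of \<open>A\<close> is then a union of orbit fibres of a single point of its inverse
  image.\<close>

lemma continuous_if_inverse_image_continuous:
  fixes \<phi> :: "'m::monoid_mult \<Rightarrow> 'n::monoid_mult" and \<U> :: "'u set set"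
  assumes univ: "set_universe TYPE('n) \<U>" and hom: "\<And>x y. \<phi> (x * y) = \<phi> x * \<phi> y"
    and \<tau>: "topspace \<tau> = UNIV" "topspace \<tau>' = UNIV"
    and f: "\<And>X. X \<in> Obj (Cont \<U> \<tau>') \<Longrightarrow> Fobj (inverse_image \<phi>) X \<in> Obj (Cont \<U> \<tau>)"
  shows "continuous_map \<tau> (action_topology \<tau>') \<phi>"
proof -
  have base: "openin \<tau> {m. \<phi> m \<in> A}" if A: "A \<in> action_base \<tau>'" for A
  proof -
    obtain e :: "'n set \<Rightarrow> 'u" where e: "inj e" "range e \<in> \<U>"
      using set_universe_powerset[OF univ] by blast
    obtain X where X: "is_mset X" "continuous_mset \<tau>' X"
      and pts: "pts X = (\<lambda>q. e (translate_preimage q A)) ` UNIV"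
      and act: "\<And>q m. act X (e (translate_preimage q A)) m = e (translate_preimage (q * m) A)"
      using translates_mset[OF e(1) A \<tau>(2)] by blast
    have "pts X \<in> \<U>"
      unfolding pts by (rule set_universe_subset[OF univ e(2)]) blast
    with X have fX: "is_mset (Fobj (inverse_image \<phi>) X)" "continuous_mset \<tau> (Fobj (inverse_image \<phi>) X)"
      using f by auto
    \<comment> \<open>Since \<phi> may move the identity, the point naming \<open>A\<close> itself
      need not be fixed by \<open>\<phi> 1\<close>. Its translate by \<open>\<phi> 1\<close> is
      fixed, because \<open>\<phi> 1\<close> is idempotent.\<close>
    let ?x = "e (translate_preimage (\<phi> 1) A)"
    have x: "?x \<in> pts X" "act X ?x (\<phi> 1) = ?x"
      using hom[of 1 1] by (simp_all add: pts act)
    have act_x: "act (Fobj (inverse_image \<phi>) X) ?x m = e (translate_preimage (\<phi> m) A)" for m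
      using x hom[of 1 m] by (simp add: act)
    have "?x \<in> pts (Fobj (inverse_image \<phi>) X)"
      using x by simp
    then have op: "openin \<tau> {m. act (Fobj (inverse_image \<phi>) X) ?x m = y}" for y
      using fX(2) unfolding continuous_mset_iff[OF fX(1) \<tau>(1)] by blast
    \<comment> \<open>Membership in \<open>A\<close> is read off a translate by testing the
      identity.\<close>
    have "\<phi> m \<in> A" if "\<phi> p \<in> A" "translate_preimage (\<phi> m) A = translate_preimage (\<phi> p) A" for m p
    proof -
      have "1 \<in> translate_preimage (\<phi> m) A"
        unfolding that(2) using that(1) by (simp add: translate_preimage_def)
      then show ?thesis
        by (simp add: translate_preimage_def)
    qed
    then have "{m. \<phi> m \<in> A} = (\<Union>p\<in>{p. \<phi> p \<in> A}.
        {m. act (Fobj (inverse_image \<phi>) X) ?x m = e (translate_preimage (\<phi> p) A)})"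
      unfolding act_x inj_eq[OF e(1)] by blast
    also have "openin \<tau> \<dots>"
      using op by (intro openin_Union) blast
    finally show ?thesis .
  qed
  show ?thesis
    unfolding continuous_map_def topspace_action_topology[OF \<tau>(2)]
  proof (intro conjI allI impI)
    fix U assume "openin (action_topology \<tau>') U"
    then obtain \<A> where \<A>: "\<A> \<subseteq> action_base \<tau>'" "\<Union>\<A> = U"
      unfolding openin_action_topology union_of_def by auto
    then have "{m \<in> topspace \<tau>. \<phi> m \<in> U} = (\<Union>A\<in>\<A>. {m. \<phi> m \<in> A})"
      using \<tau>(1) by auto
    also have "openin \<tau> \<dots>"
      using base \<A>(1) by (intro openin_Union) blast
    finally show "openin \<tau> {m \<in> topspace \<tau>. \<phi> m \<in> U}" .
  qed simp
qed

text \<open>\<open>f_dir\<close>, \<open>R\<close> and \<open>R'\<close> are arbitrary functors with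
  the stated adjunctions, so the equivalence holds for every choice of these adjoints. The
  inclusions are the identity on data and only change the category in which an object is
  read.\<close>

theorem lemma4p2:
  fixes \<phi> :: "'m::monoid_mult \<Rightarrow> 'n::monoid_mult"
    and \<tau> :: "'m topology" and \<tau>' :: "'n topology"
    and \<U> :: "'u set set"
    and f_shriek :: "(('u, 'm) mset, 'u \<Rightarrow> 'u, ('u, 'n) mset, 'u \<Rightarrow> 'u) ftor"
    and f_dir :: "(('u, 'm) mset, 'u \<Rightarrow> 'u, ('u, 'n) mset, 'u \<Rightarrow> 'u) ftor"
    and R :: "(('u, 'm) mset, 'u \<Rightarrow> 'u, ('u, 'm) mset, 'u \<Rightarrow> 'u) ftor"
    and R' :: "(('u, 'n) mset, 'u \<Rightarrow> 'u, ('u, 'n) mset, 'u \<Rightarrow> 'u) ftor"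
  assumes universe: "set_universe TYPE('m) \<U>" "set_universe TYPE('n) \<U>"
    and semigroup_hom: "\<And>x y. \<phi> (x * y) = \<phi> x * \<phi> y"
    and topologies: "topspace \<tau> = UNIV" "topspace \<tau>' = UNIV"
    and f: "essential_geometric_morphism (PSh \<U>) (PSh \<U>) f_shriek (inverse_image \<phi>) f_dir"
    and R: "adjunction (Cont \<U> \<tau>) (PSh \<U>) inclusion_functor R"
    and R': "adjunction (Cont \<U> \<tau>') (PSh \<U>) inclusion_functor R'"
  shows "((\<forall>X\<in>Obj (Cont \<U> \<tau>'). Fobj (inverse_image \<phi>) X \<in> Obj (Cont \<U> \<tau>))
            \<longleftrightarrow> continuous_map \<tau> (action_topology \<tau>') \<phi>)
       \<and> (continuous_map \<tau> (action_topology \<tau>') \<phi>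
            \<longleftrightarrow> (\<exists>G. geometric_morphism (Cont \<U> \<tau>) (Cont \<U> \<tau>')
                       (R \<circ>\<^sub>F inverse_image \<phi> \<circ>\<^sub>F inclusion_functor) G
                     \<and> nat_iso (PSh \<U>) (Cont \<U> \<tau>') (G \<circ>\<^sub>F R) (R' \<circ>\<^sub>F f_dir)))"
proof -
  note cat = is_category_PSh[of \<U>] is_category_Cont[of \<U>]
  have f_adj: "adjunction (PSh \<U>) (PSh \<U>) (inverse_image \<phi>) f_dir"
    and f_lex: "left_exact (PSh \<U>) (PSh \<U>) (inverse_image \<phi>)"
    using f unfolding essential_geometric_morphism_def geometric_morphism_def by auto
  \<comment> \<open>That the fixed points form an M-set with carrier in the universe is part of
    \<open>inverse_image \<phi>\<close> being a functor between the presheaf categories.\<close>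
  have f_mset: "Fobj (inverse_image \<phi>) X \<in> Obj (PSh \<U>)" if "X \<in> Obj (Cont \<U> \<tau>')" for X
    using functor_obj[of "PSh \<U>" "PSh \<U>" "inverse_image \<phi>" X] f_lex that
    unfolding left_exact_def by simp
  have adj: "adjunction (Cont \<U> \<tau>') (PSh \<U>) (inverse_image \<phi>) (R' \<circ>\<^sub>F f_dir)"
    using adjunction_comp[OF R' f_adj cat(2,1,1)] by (simp add: comp_inclusion_functor)
  have "(\<forall>X\<in>Obj (Cont \<U> \<tau>'). Fobj (inverse_image \<phi>) X \<in> Obj (Cont \<U> \<tau>))
      \<longleftrightarrow> continuous_map \<tau> (action_topology \<tau>') \<phi>" (is "?lift \<longleftrightarrow> _")
  proof
    assume ?lift
    then show "continuous_map \<tau> (action_topology \<tau>') \<phi>"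
      using continuous_if_inverse_image_continuous[of \<U> \<phi> \<tau> \<tau>'] universe(2) semigroup_hom topologies
      by blast
  next
    assume \<phi>: "continuous_map \<tau> (action_topology \<tau>') \<phi>"
    show ?lift
    proof
      fix X assume "X \<in> Obj (Cont \<U> \<tau>')"
      then show "Fobj (inverse_image \<phi>) X \<in> Obj (Cont \<U> \<tau>)"
        using continuous_inverse_image[OF \<phi> topologies, of X] f_mset[of X] by simp
    qed
  qed
  moreover have "?lift \<longleftrightarrow> (\<exists>G. geometric_morphism (Cont \<U> \<tau>) (Cont \<U> \<tau>') (R \<circ>\<^sub>F inverse_image \<phi>) G
      \<and> nat_iso (PSh \<U>) (Cont \<U> \<tau>') (G \<circ>\<^sub>F R) (R' \<circ>\<^sub>F f_dir))" (is "_ \<longleftrightarrow> ?descends")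
  proof
    assume lift: ?lift
    \<comment> \<open>Read on continuous M-sets only, \<open>R' \<circ>\<^sub>F f_dir\<close> is the
      functor \<open>G\<close>; composing with the inclusion leaves its data unchanged.\<close>
    have adj_Cont: "adjunction (Cont \<U> \<tau>') (Cont \<U> \<tau>) (inverse_image \<phi>) (R' \<circ>\<^sub>F f_dir)"
      unfolding Cont_def[of \<U> \<tau>]
      by (rule adjunction_full_subcategory[OF adj cat(2,1)]) (use lift in auto)
    have R_lex: "left_exact (PSh \<U>) (Cont \<U> \<tau>) R"
      by (rule left_exact_right_adjoint[OF R cat(2,1)])
    \<comment> \<open>The inclusion, the inverse image and \<open>R\<close> are left exact in turn,
      the last one as a right adjoint.\<close>
    have lex: "left_exact (Cont \<U> \<tau>') (Cont \<U> \<tau>) (R \<circ>\<^sub>F inverse_image \<phi>)"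
      using left_exact_comp[OF left_exact_comp[OF left_exact_Cont_inclusion[OF universe(2) topologies(2)] f_lex] R_lex]
      by (simp add: comp_inclusion_functor)
    \<comment> \<open>On continuous M-sets \<open>R\<close> is isomorphic to the identity, so
      composing with \<open>R\<close> changes the lifted functor only by an isomorphism.\<close>
    have "nat_iso (Cont \<U> \<tau>) (Cont \<U> \<tau>) inclusion_functor R"
      using coreflection_unit_iso[OF R[unfolded Cont_def] cat(1)] unfolding Cont_def .
    from nat_iso_whisker[OF this, of _ "inverse_image \<phi>"]
    have "nat_iso (Cont \<U> \<tau>') (Cont \<U> \<tau>) (inverse_image \<phi>) (R \<circ>\<^sub>F inverse_image \<phi>)"
      using adj_Cont unfolding inclusion_comp_functor adjunction_def by blast
    then have "geometric_morphism (Cont \<U> \<tau>) (Cont \<U> \<tau>') (R \<circ>\<^sub>F inverse_image \<phi>) (R' \<circ>\<^sub>F f_dir)"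
      using adjunction_nat_iso_left[OF adj_Cont _ _ cat(2,2)] lex
      unfolding geometric_morphism_def left_exact_def by blast
    \<comment> \<open>Both functors are right adjoint to the inverse image as a functor from
      \<open>Cont \<U> \<tau>'\<close> to \<open>PSh \<U>\<close>.\<close>
    moreover have "nat_iso (PSh \<U>) (Cont \<U> \<tau>') (R' \<circ>\<^sub>F f_dir \<circ>\<^sub>F R) (R' \<circ>\<^sub>F f_dir)"
      using right_adjoint_unique[OF adjunction_comp[OF adj_Cont R cat(2,2,1), unfolded inclusion_comp_functor] adj cat(2,1)] .
    ultimately show ?descends by blast
  next
    assume ?descends
    then obtain G where G: "adjunction (Cont \<U> \<tau>') (Cont \<U> \<tau>) (R \<circ>\<^sub>F inverse_image \<phi>) G"
      and iso: "nat_iso (PSh \<U>) (Cont \<U> \<tau>') (G \<circ>\<^sub>F R) (R' \<circ>\<^sub>F f_dir)"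
      unfolding geometric_morphism_def by blast
    \<comment> \<open>Followed by the inclusion,
      \<open>R \<circ>\<^sub>F inverse_image \<phi>\<close> is left adjoint to
      \<open>G \<circ>\<^sub>F R\<close>. Isomorphic right adjoints then force isomorphic left
      adjoints.\<close>
    note GR = adjunction_comp[OF G R cat(2,2,1), unfolded inclusion_comp_functor]
    show ?lift
    proof
      fix X assume X: "X \<in> Obj (Cont \<U> \<tau>')"
      let ?Y = "Fobj (R \<circ>\<^sub>F inverse_image \<phi>) X"
      obtain h where h: "is_iso (PSh \<U>) (Fobj (inverse_image \<phi>) X) ?Y h"
        using left_adjoint_unique[OF GR adj iso cat(2,1) X] by blast
      have "?Y \<in> Obj (Cont \<U> \<tau>)"
        using G X unfolding adjunction_def by (blast intro: functor_obj)
      moreover have "inj_on h (pts (Fobj (inverse_image \<phi>) X))"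
      proof (rule inj_onI)
        obtain g where "compose (pts (Fobj (inverse_image \<phi>) X)) g h = (\<lambda>x\<in>pts (Fobj (inverse_image \<phi>) X). x)"
          using h unfolding is_iso_def by auto
        then have gh: "g (h x) = x" if "x \<in> pts (Fobj (inverse_image \<phi>) X)" for x
          using that by (metis compose_eq restrict_apply')
        fix x y assume "x \<in> pts (Fobj (inverse_image \<phi>) X)" "y \<in> pts (Fobj (inverse_image \<phi>) X)" "h x = h y"
        then show "x = y" using gh by metis
      qed
      ultimately have "continuous_mset \<tau> (Fobj (inverse_image \<phi>) X)"
        using continuous_mset_inj[OF _ _ _ topologies(1), of _ ?Y h] h f_mset[OF X]
        unfolding is_iso_def by simp
      then show "Fobj (inverse_image \<phi>) X \<in> Obj (Cont \<U> \<tau>)"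
        using f_mset[OF X] by simp
    qed
  qed
  ultimately show ?thesis
    unfolding comp_inclusion_functor by blast
qed

end
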